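(* Let $\{\mathbb{G}(v):v\in\mathbb{R}\}$ be a Gaussian process with $\mathbb{E}[\mathbb{G}(v)]=\mu(v)$ and $\mathrm{Cov}[\mathbb{G}(v),\mathbb{G}(u)]=C(|v|\wedge|u|)\mathbb{1}(\mathrm{sign}(v)=\mathrm{sign}(u))$ for some $C>0$. Suppose that for each $v\in\mathbb{R}$, $\lim_{\delta\downarrow0}[\mu(v+\delta)-\mu(v)]/\sqrt{\delta}=0$, and that $\limsup_{|v|\to\infty}\mu(v)/|v|^{c}=-\infty$ for some $c>1/2$. Then the function $x\mapsto\mathbb{P}[\operatorname{argmax}_{v\in\mathbb{R}}\{\mathbb{G}(v)\}\le x]$ is continuous on $\mathbb{R}$.
   Context: $\mathbb{G}$ is a scalar multiple of two-sided Brownian motion (with continuous paths, zero at $v=0$) plus the deterministic mean function $\mu$. Here $a\wedge b=\min(a,b)$. $\operatorname{argmax}_{v\in\mathbb{R}}\{\mathbb{G}(v)\}$ denotes the maximizer of $\mathbb{G}$ over $\mathbb{R}$, which the paper takes, as a known fact (Kim and Pollard, 1990), to exist and be unique with probability one under the stated conditions on $\mu$. *)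

theory Defs
  imports "HOL-Probability.Probability"
begin

(* Normal laws on the real line, including the degenerate ones. *)
definition normal_law :: "real \<Rightarrow> real \<Rightarrow> real measure" where
  "normal_law m s = (if s = 0 then return borel m else density lborel (normal_density m s))"

(* Joint normality of all finite-dimensional marginals: every finite linear combination is
   normal, where the degenerate case of zero variance is allowed. *)
definition gaussian_process :: "'a measure \<Rightarrow> ('t \<Rightarrow> 'a \<Rightarrow> real) \<Rightarrow> bool" where
  "gaussian_process M X \<longleftrightarrow>
     (\<forall>t. X t \<in> borel_measurable M) \<and>
     (\<forall>J a. finite J \<longrightarrow>
        (\<exists>m s. 0 \<le> s \<and> distr M borel (\<lambda>\<omega>. \<Sum>t\<in>J. a t * X t \<omega>) = normal_law m s))"

definition covariance :: "'a measure \<Rightarrow> ('a \<Rightarrow> real) \<Rightarrow> ('a \<Rightarrow> real) \<Rightarrow> real" where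
  "covariance M X Y =
     integral\<^sup>L M (\<lambda>\<omega>. (X \<omega> - integral\<^sup>L M X) * (Y \<omega> - integral\<^sup>L M Y))"

(* P[argmax f <= x].  The library's arg_max is an arbitrary real number when f has no maximizer
   and an arbitrary maximizer when there are several, so the event requires the maximizer to
   exist and to be unique; when this holds almost surely, the requirement does not affect the
   probability.  The completion is used because the exceptional null set, and hence the event,
   need not be measurable in M. *)
definition argmax_cdf :: "'a measure \<Rightarrow> (real \<Rightarrow> 'a \<Rightarrow> real) \<Rightarrow> real \<Rightarrow> real" where
  "argmax_cdf M G x = measure (completion M)
     {\<omega> \<in> space M. (\<exists>!v. is_arg_max (\<lambda>v. G v \<omega>) (\<lambda>_. True) v) \<and>
                   arg_max (\<lambda>v. G v \<omega>) (\<lambda>_. True) \<le> x}"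

end

(*
  Fix x and d_n = d_0 / 4^n: the normalized increments of G
  over [x, x + d_n] are Gaussian with unit variance, mean tending to 0 and correlations 2^-|n-m|,
  so almost surely one of them is positive and x is not a maximizer. Hence the law of the maximizer
  has no atoms.

  It remains to see that the events {argmax <= x} are measurable up to null sets. For p < q on the
  same side of 0, replacing the increment G q - G p by an independent copy does not change the law
  of G but shifts the difference of the suprema over the rationals in (-oo, p) and [q, oo); so
  these suprema almost surely do not tie. Since moreover the paths are right-continuous, a maximizer
  must then be the infimum of the rationals r for which the supremum over the rationals below r is
  already the overall supremum, and this infimum is measurable.
*)

theory Submission
  imports Defs
begin

subsection \<open>Finite-dimensional laws and characteristic functions\<close>

text \<open>The drift \<open>\<mu>\<close> is controlled from the right only. That its increments
  over [v, v + \<delta>] are o(sqrt \<delta>) is what makes the means of the normalized increments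
  vanish in the limit, but left limits may exceed the value or fail to exist. So a path with a
  unique maximizer could still approach its supremum further to the left without attaining it, and
  the infimum that should locate the maximizer would be too small. Excluding ties between one-sided
  suprema rules this out. Resampling an increment compares path laws on infinitely many times. These
  are determined by finite-dimensional laws, and those by the characteristic functions of finite
  linear combinations; the multivariate uniqueness statement is derived here from Levy's theorem on
  the line. The ratio 4 makes sqrt d_n halve at each step, so the correlations are summable and a
  centered sum of N normalized increments has variance O(N). If all of them were nonpositive on an
  event of positive probability, the integral of that sum over the event would be of order -N, which
  contradicts Cauchy-Schwarz.\<close>

lemma measure_eq_if_char_eq:
  fixes X :: "'a \<Rightarrow> real" and Y :: "'b \<Rightarrow> real"
  assumes "finite_measure P" "finite_measure Q"
    and [measurable]: "X \<in> borel_measurable P" "Y \<in> borel_measurable Q"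
    and eq: "\<And>s. (CLINT \<omega>|P. iexp (s * X \<omega>)) = (CLINT \<omega>|Q. iexp (s * Y \<omega>))"
    and [measurable]: "A \<in> sets borel"
  shows "measure P {\<omega>\<in>space P. X \<omega> \<in> A} = measure Q {\<omega>\<in>space Q. Y \<omega> \<in> A}"
proof -
  interpret P: finite_measure P by fact
  interpret Q: finite_measure Q by fact
  define m where "m = measure P (space P)"
  \<comment> \<open>At frequency 0 the characteristic functions are the total masses, so one common
    factor rescales both measures to probability measures.\<close>
  have mQ: "m = measure Q (space Q)"
    using eq[of 0] by (simp add: m_def)
  have "m \<ge> 0" by (simp add: m_def)
  show ?thesis
  proof (cases "m = 0")
    case True
    then have "measure P {\<omega>\<in>space P. X \<omega> \<in> A} = 0" "measure Q {\<omega>\<in>space Q. Y \<omega> \<in> A} = 0"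
      using P.bounded_measure[of "{\<omega>\<in>space P. X \<omega> \<in> A}"] Q.bounded_measure[of "{\<omega>\<in>space Q. Y \<omega> \<in> A}"]
      by (simp_all add: m_def mQ[unfolded m_def] measure_le_0_iff)
    then show ?thesis by simp
  next
    case False
    with \<open>m \<ge> 0\<close> have "m > 0" by simp
    define P1 where "P1 = density P (\<lambda>_. ennreal (1 / m))"
    define Q1 where "Q1 = density Q (\<lambda>_. ennreal (1 / m))"
    have [measurable]: "X \<in> borel_measurable P1" "Y \<in> borel_measurable Q1"
      by (simp_all add: P1_def Q1_def)
    have P1: "prob_space P1"
      by (rule prob_spaceI) (use \<open>m > 0\<close> in \<open>simp add: P1_def emeasure_density P.emeasure_eq_measure
          m_def[symmetric] ennreal_mult[symmetric] flip: ennreal_1\<close>)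
    have Q1: "prob_space Q1"
      by (rule prob_spaceI) (use \<open>m > 0\<close> in \<open>simp add: Q1_def emeasure_density Q.emeasure_eq_measure
          mQ[symmetric] ennreal_mult[symmetric] flip: ennreal_1\<close>)
    have "distr P1 borel X = distr Q1 borel Y"
    proof (rule Levy_uniqueness)
      show "real_distribution (distr P1 borel X)" "real_distribution (distr Q1 borel Y)"
        using P1 Q1 by (auto intro!: prob_space.real_distribution_distr)
      have "(CLINT \<omega>|P1. iexp (s * X \<omega>)) = (CLINT \<omega>|Q1. iexp (s * Y \<omega>))" for s
        using \<open>m > 0\<close> eq[of s] by (simp add: P1_def Q1_def integral_density)
      then show "char (distr P1 borel X) = char (distr Q1 borel Y)"
        by (simp add: char_def fun_eq_iff integral_distr)
    qed
    then have "emeasure (distr P1 borel X) A = emeasure (distr Q1 borel Y) A" by simp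
    then have "emeasure P1 {\<omega>\<in>space P. X \<omega> \<in> A} = emeasure Q1 {\<omega>\<in>space Q. Y \<omega> \<in> A}"
      by (simp add: emeasure_distr vimage_def Int_def conj_commute P1_def Q1_def)
    then have "ennreal (1 / m) * emeasure P {\<omega>\<in>space P. X \<omega> \<in> A}
        = ennreal (1 / m) * emeasure Q {\<omega>\<in>space Q. Y \<omega> \<in> A}"
      by (simp add: P1_def Q1_def emeasure_density nn_integral_cmult_indicator)
    then show ?thesis
      using \<open>m > 0\<close> by (simp add: P.emeasure_eq_measure Q.emeasure_eq_measure ennreal_mult[symmetric])
  qed
qed

text \<open>A nonnegative integrable weight is absorbed into the measure: \<open>density P g\<close>
  and \<open>density Q h\<close> are finite, and \<open>eq\<close> says that X and Y have equal
  characteristic functions under them.\<close>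

lemma weighted_integral_eq_if_char_eq:
  fixes X g :: "'a \<Rightarrow> real" and Y h :: "'b \<Rightarrow> real"
  assumes [measurable]: "X \<in> borel_measurable P" "Y \<in> borel_measurable Q"
    and g: "integrable P g" "\<And>\<omega>. g \<omega> \<ge> 0" and h: "integrable Q h" "\<And>\<omega>. h \<omega> \<ge> 0"
    and eq: "\<And>s. (CLINT \<omega>|P. g \<omega> * iexp (s * X \<omega>)) = (CLINT \<omega>|Q. h \<omega> * iexp (s * Y \<omega>))"
    and A [measurable]: "A \<in> sets borel"
  shows "(\<integral>\<omega>. indicator A (X \<omega>) * g \<omega> \<partial>P) = (\<integral>\<omega>. indicator A (Y \<omega>) * h \<omega> \<partial>Q)"
proof -
  have [measurable]: "g \<in> borel_measurable P" "h \<in> borel_measurable Q"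
    using g h by auto
  have fin: "finite_measure (density N f)" if "integrable N f" "\<And>x. f x \<ge> 0"
    for N :: "'c measure" and f :: "'c \<Rightarrow> real"
    using that by (intro finite_measureI) (simp add: emeasure_density nn_integral_eq_integral)
  have *: "measure (density N f) {\<omega>\<in>space (density N f). Z \<omega> \<in> A} = (\<integral>\<omega>. indicator A (Z \<omega>) * f \<omega> \<partial>N)"
    if [measurable]: "integrable N f" "Z \<in> borel_measurable N" and f: "\<And>x. f x \<ge> 0"
    for N :: "'c measure" and f Z :: "'c \<Rightarrow> real"
  proof -
    have [measurable]: "f \<in> borel_measurable N" using that by auto
    have "measure (density N f) {\<omega>\<in>space (density N f). Z \<omega> \<in> A}
        = (\<integral>\<omega>. indicator {\<omega>\<in>space N. Z \<omega> \<in> A} \<omega> \<partial>density N f)"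
      by simp
    also have "\<dots> = (\<integral>\<omega>. f \<omega> * indicator {\<omega>\<in>space N. Z \<omega> \<in> A} \<omega> \<partial>N)"
      using f by (subst integral_density) auto
    also have "\<dots> = (\<integral>\<omega>. indicator A (Z \<omega>) * f \<omega> \<partial>N)"
      by (intro Bochner_Integration.integral_cong) (auto simp: indicator_def)
    finally show ?thesis .
  qed
  have "measure (density P g) {\<omega>\<in>space (density P g). X \<omega> \<in> A}
      = measure (density Q h) {\<omega>\<in>space (density Q h). Y \<omega> \<in> A}"
  proof (rule measure_eq_if_char_eq)
    show "(CLINT \<omega>|density P g. iexp (s * X \<omega>)) = (CLINT \<omega>|density Q h. iexp (s * Y \<omega>))" for s
      using g(2) h(2) eq[of s] by (simp add: integral_density scaleR_conv_of_real)
  qed (use g h fin in auto)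
  then show ?thesis
    using *[OF g(1) _ g(2), of X] *[OF h(1) _ h(2), of Y] by simp
qed

lemma (in finite_measure) integrable_iexp':
  assumes [measurable]: "f \<in> borel_measurable M"
  shows "complex_integrable M (\<lambda>\<omega>. iexp (f \<omega>))"
  by (intro integrable_const_bound[of _ 1]) auto

text \<open>Induction on the coordinates: restricting both measures to the event that coordinate
  \<open>j\<close> lies in \<open>A j\<close> leaves a statement about \<open>J\<close>. The
  restricted measures are not probabilities, hence the formulation for finite measures. The
  induction hypothesis needs the characteristic functions of the other coordinates under the
  restriction, that is, integrals with the complex weight \<open>iexp V\<close>. This is no density,
  so its real and imaginary parts are made nonnegative by adding 1.\<close>

theorem finite_dimensional_eq_if_char_eq:
  fixes X :: "'t \<Rightarrow> 'a \<Rightarrow> real" and Y :: "'t \<Rightarrow> 'b \<Rightarrow> real"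
  assumes "finite J" "finite_measure P" "finite_measure Q"
    and "\<And>t. t \<in> J \<Longrightarrow> X t \<in> borel_measurable P" "\<And>t. t \<in> J \<Longrightarrow> Y t \<in> borel_measurable Q"
    and "\<And>a. (CLINT \<omega>|P. iexp (\<Sum>t\<in>J. a t * X t \<omega>)) = (CLINT \<omega>|Q. iexp (\<Sum>t\<in>J. a t * Y t \<omega>))"
    and "\<And>t. t \<in> J \<Longrightarrow> A t \<in> sets borel"
  shows "measure P {\<omega>\<in>space P. \<forall>t\<in>J. X t \<omega> \<in> A t} = measure Q {\<omega>\<in>space Q. \<forall>t\<in>J. Y t \<omega> \<in> A t}"
  using assms
proof (induction J arbitrary: P Q rule: finite_induct)
  case empty
  from empty(5) have "complex_of_real (measure P (space P)) = of_real (measure Q (space Q))"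
    by (simp add: scaleR_conv_of_real)
  then show ?case by (simp only: of_real_eq_iff) simp
next
  case (insert j J)
  interpret P: finite_measure P by fact
  interpret Q: finite_measure Q by fact
  have [measurable]: "X j \<in> borel_measurable P" "Y j \<in> borel_measurable Q" "A j \<in> sets borel"
    "\<And>t. t \<in> J \<Longrightarrow> X t \<in> borel_measurable P" "\<And>t. t \<in> J \<Longrightarrow> Y t \<in> borel_measurable Q"
    "\<And>t. t \<in> J \<Longrightarrow> A t \<in> sets borel"
    using insert.prems by auto
  define P' where "P' = density P (indicator {\<omega>\<in>space P. X j \<omega> \<in> A j})"
  define Q' where "Q' = density Q (indicator {\<omega>\<in>space Q. Y j \<omega> \<in> A j})"
  have P': "measure P' {\<omega>\<in>space P'. \<forall>t\<in>J. X t \<omega> \<in> A t} = measure P {\<omega>\<in>space P. \<forall>t\<in>insert j J. X t \<omega> \<in> A t}"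
    using \<open>finite J\<close> unfolding P'_def
    by (subst measure_def, subst emeasure_density)
      (auto simp: measure_def  indicator_inter_arith[symmetric] intro!: arg_cong[where f=enn2real] arg_cong2[where f=emeasure])
  have Q': "measure Q' {\<omega>\<in>space Q'. \<forall>t\<in>J. Y t \<omega> \<in> A t} = measure Q {\<omega>\<in>space Q. \<forall>t\<in>insert j J. Y t \<omega> \<in> A t}"
    using \<open>finite J\<close> unfolding Q'_def
    by (subst measure_def, subst emeasure_density)
      (auto simp: measure_def indicator_inter_arith[symmetric] intro!: arg_cong[where f=enn2real] arg_cong2[where f=emeasure])
  have "measure P' {\<omega>\<in>space P'. \<forall>t\<in>J. X t \<omega> \<in> A t} = measure Q' {\<omega>\<in>space Q'. \<forall>t\<in>J. Y t \<omega> \<in> A t}"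
  proof (rule insert.IH)
    show "finite_measure P'" "finite_measure Q'"
      unfolding P'_def Q'_def
      by (auto intro!: finite_measureI simp: emeasure_density P.emeasure_eq_measure Q.emeasure_eq_measure)
    show "\<And>t. t \<in> J \<Longrightarrow> X t \<in> borel_measurable P'" "\<And>t. t \<in> J \<Longrightarrow> Y t \<in> borel_measurable Q'"
      by (auto simp: P'_def Q'_def)
    fix a
    define V W where "V \<omega> = (\<Sum>t\<in>J. a t * X t \<omega>)" and "W \<omega>2 = (\<Sum>t\<in>J. a t * Y t \<omega>2)" for \<omega> \<omega>2
    have [measurable]: "V \<in> borel_measurable P" "W \<in> borel_measurable Q"
      by (simp_all add: V_def[abs_def] W_def[abs_def])
    have base: "(CLINT \<omega>|P. iexp (c * V \<omega> + s * X j \<omega>)) = (CLINT \<omega>|Q. iexp (c * W \<omega> + s * Y j \<omega>))" for c s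
    proof -
      have eq: "(\<Sum>t\<in>insert j J. ((\<lambda>t. c * a t)(j := s)) t * Z t) = c * (\<Sum>t\<in>J. a t * Z t) + s * Z j"
        for Z :: "'t \<Rightarrow> real"
      proof -
        have "(\<Sum>t\<in>J. ((\<lambda>t. c * a t)(j := s)) t * Z t) = (\<Sum>t\<in>J. c * (a t * Z t))"
          using insert.hyps by (intro sum.cong) auto
        then show ?thesis using insert.hyps by (simp add: sum_distrib_left)
      qed
      show ?thesis
        using insert.prems(5)[of "(\<lambda>t. c * a t)(j := s)"] unfolding eq V_def W_def .
    qed
    have ex1: "iexp (v + x) = iexp v * iexp x" for v x :: real
      by (simp add: distrib_left exp_add)
    have ex2: "iexp (x - v) = exp (- (\<i> * v)) * iexp x" for v x :: real
      by (simp only: exp_add[symmetric]) (simp add: algebra_simps)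
    \<comment> \<open>By Euler's formula the weighted exponential is a combination of the
      exponentials at x, v + x and x - v; these are the cases c = 0, 1, -1 of
      \<open>base\<close>.\<close>
    have cos_iexp: "complex_of_real (1 + cos v) * iexp x = iexp x + iexp (v + x) / 2 + iexp (x - v) / 2" for v x
    proof -
      have e: "complex_of_real (1 + cos v) = 1 + (iexp v + exp (- (\<i> * v))) / 2"
        by (simp add: cos_of_real[symmetric] cos_exp_eq del: cos_of_real)
      show ?thesis unfolding ex1 ex2 e by (simp add: field_simps)
    qed
    have sin_iexp: "complex_of_real (1 + sin v) * iexp x = iexp x + iexp (v + x) / (2 * \<i>) - iexp (x - v) / (2 * \<i>)" for v x
    proof -
      have e: "complex_of_real (1 + sin v) = 1 + (iexp v - exp (- (\<i> * v))) / (2 * \<i>)"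
        by (simp add: sin_of_real[symmetric] sin_exp_eq del: sin_of_real)
      show ?thesis unfolding ex1 ex2 e by (simp add: field_simps)
    qed
    have b0: "(CLINT \<omega>|P. iexp (s * X j \<omega>)) = (CLINT \<omega>|Q. iexp (s * Y j \<omega>))"
      and b1: "(CLINT \<omega>|P. iexp (V \<omega> + s * X j \<omega>)) = (CLINT \<omega>|Q. iexp (W \<omega> + s * Y j \<omega>))"
      and b2: "(CLINT \<omega>|P. iexp (s * X j \<omega> - V \<omega>)) = (CLINT \<omega>|Q. iexp (s * Y j \<omega> - W \<omega>))" for s
      using base[of 0 s] base[of 1 s] base[of "-1" s] by simp_all
    note int = P.integrable_iexp' Q.integrable_iexp'
    have 1: "(\<integral>\<omega>. indicat_real (A j) (X j \<omega>) * 1 \<partial>P) = (\<integral>\<omega>. indicator (A j) (Y j \<omega>) * 1 \<partial>Q)"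
      by (rule weighted_integral_eq_if_char_eq[where g = "\<lambda>_. 1" and h = "\<lambda>_. 1"]) (use base[of 0] in auto)
    have 2: "(\<integral>\<omega>. indicator (A j) (X j \<omega>) * (1 + cos (V \<omega>)) \<partial>P)
        = (\<integral>\<omega>. indicator (A j) (Y j \<omega>) * (1 + cos (W \<omega>)) \<partial>Q)"
    proof (rule weighted_integral_eq_if_char_eq)
      show "integrable P (\<lambda>\<omega>. 1 + cos (V \<omega>))" "integrable Q (\<lambda>\<omega>. 1 + cos (W \<omega>))"
        by (intro Bochner_Integration.integrable_add P.integrable_const Q.integrable_const
            P.integrable_const_bound[of _ 1] Q.integrable_const_bound[of _ 1]; simp)+
      show "0 \<le> 1 + cos (V \<omega>)" "0 \<le> 1 + cos (W \<omega>')" for \<omega> \<omega>'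
        using cos_ge_minus_one[of "V \<omega>"] cos_ge_minus_one[of "W \<omega>'"] by linarith+
      show "(CLINT \<omega>|P. (1 + cos (V \<omega>)) * iexp (s * X j \<omega>)) = (CLINT \<omega>|Q. (1 + cos (W \<omega>)) * iexp (s * Y j \<omega>))" for s
        unfolding cos_iexp by (simp add: b0 b1 b2 int del: of_real_add of_real_mult of_real_diff)
    qed auto
    have 3: "(\<integral>\<omega>. indicator (A j) (X j \<omega>) * (1 + sin (V \<omega>)) \<partial>P)
        = (\<integral>\<omega>. indicator (A j) (Y j \<omega>) * (1 + sin (W \<omega>)) \<partial>Q)"
    proof (rule weighted_integral_eq_if_char_eq)
      show "integrable P (\<lambda>\<omega>. 1 + sin (V \<omega>))" "integrable Q (\<lambda>\<omega>. 1 + sin (W \<omega>))"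
        by (intro Bochner_Integration.integrable_add P.integrable_const Q.integrable_const
            P.integrable_const_bound[of _ 1] Q.integrable_const_bound[of _ 1]; simp)+
      show "0 \<le> 1 + sin (V \<omega>)" "0 \<le> 1 + sin (W \<omega>')" for \<omega> \<omega>'
        using sin_ge_minus_one[of "V \<omega>"] sin_ge_minus_one[of "W \<omega>'"] by linarith+
      show "(CLINT \<omega>|P. (1 + sin (V \<omega>)) * iexp (s * X j \<omega>)) = (CLINT \<omega>|Q. (1 + sin (W \<omega>)) * iexp (s * Y j \<omega>))" for s
        unfolding sin_iexp by (simp add: b0 b1 b2 int del: of_real_add of_real_mult of_real_diff)
    qed auto
    have bdd [intro]: "integrable N (\<lambda>\<omega>. indicator (A j) (Z \<omega>) * f \<omega>)"
      if "finite_measure N" and [measurable]: "Z \<in> borel_measurable N" "f \<in> borel_measurable N"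
        and "\<And>\<omega>. \<bar>f \<omega>\<bar> \<le> 1" for N :: "'c measure" and f Z :: "'c \<Rightarrow> real"
      using that by (intro finite_measure.integrable_const_bound[of _ _ 1]) (auto simp: indicator_def abs_mult)
    note bddP = bdd[OF P.finite_measure_axioms] and bddQ = bdd[OF Q.finite_measure_axioms]
    \<comment> \<open>Subtracting the integral with constant weight 1 undoes the shift that made the
      weight nonnegative.\<close>
    have 4: "(\<integral>\<omega>. indicator (A j) (X j \<omega>) * cos (V \<omega>) \<partial>P) = (\<integral>\<omega>. indicator (A j) (Y j \<omega>) * cos (W \<omega>) \<partial>Q)"
      using 1 2 bddP[of "X j" "\<lambda>_. 1"] bddQ[of "Y j" "\<lambda>_. 1"] bddP[of "X j" "\<lambda>\<omega>. cos (V \<omega>)"] bddQ[of "Y j" "\<lambda>\<omega>. cos (W \<omega>)"]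
      by (simp add: distrib_left)
    have 5: "(\<integral>\<omega>. indicator (A j) (X j \<omega>) * sin (V \<omega>) \<partial>P) = (\<integral>\<omega>. indicator (A j) (Y j \<omega>) * sin (W \<omega>) \<partial>Q)"
      using 1 3 bddP[of "X j" "\<lambda>_. 1"] bddQ[of "Y j" "\<lambda>_. 1"] bddP[of "X j" "\<lambda>\<omega>. sin (V \<omega>)"] bddQ[of "Y j" "\<lambda>\<omega>. sin (W \<omega>)"]
      by (simp add: distrib_left)
    have split: "(CLINT \<omega>|density N (indicator {\<omega>\<in>space N. Z \<omega> \<in> A j}). iexp (f \<omega>))
        = of_real (\<integral>\<omega>. indicator (A j) (Z \<omega>) * cos (f \<omega>) \<partial>N) + \<i> * of_real (\<integral>\<omega>. indicator (A j) (Z \<omega>) * sin (f \<omega>) \<partial>N)"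
      if "finite_measure N" and [measurable]: "Z \<in> borel_measurable N" "f \<in> borel_measurable N"
      for N :: "'c measure" and f Z :: "'c \<Rightarrow> real"
    proof -
      have i: "integrable N (\<lambda>\<omega>. indicator (A j) (Z \<omega>) * cos (f \<omega>))" "integrable N (\<lambda>\<omega>. indicator (A j) (Z \<omega>) * sin (f \<omega>))"
        using that by (auto intro!: bdd)
      have "(CLINT \<omega>|density N (indicator {\<omega>\<in>space N. Z \<omega> \<in> A j}). iexp (f \<omega>))
          = (CLINT \<omega>|density N (\<lambda>\<omega>. ennreal (indicator {\<omega>\<in>space N. Z \<omega> \<in> A j} \<omega>)). iexp (f \<omega>))"
        by (simp add: ennreal_indicator)
      also have "\<dots> = (CLINT \<omega>|N. indicator {\<omega>\<in>space N. Z \<omega> \<in> A j} \<omega> *\<^sub>R iexp (f \<omega>))"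
        by (subst integral_density) auto
      also have "\<dots> = (CLINT \<omega>|N. of_real (indicator (A j) (Z \<omega>) * cos (f \<omega>)) + \<i> * of_real (indicator (A j) (Z \<omega>) * sin (f \<omega>)))"
        by (intro Bochner_Integration.integral_cong) (auto simp: indicator_def cis_conv_exp[symmetric] complex_eq_iff)
      also have "\<dots> = of_real (\<integral>\<omega>. indicator (A j) (Z \<omega>) * cos (f \<omega>) \<partial>N) + \<i> * of_real (\<integral>\<omega>. indicator (A j) (Z \<omega>) * sin (f \<omega>) \<partial>N)"
        using i by (subst Bochner_Integration.integral_add) (auto simp del: of_real_mult)
      finally show ?thesis .
    qed
    show "(CLINT \<omega>|P'. iexp (\<Sum>t\<in>J. a t * X t \<omega>)) = (CLINT \<omega>|Q'. iexp (\<Sum>t\<in>J. a t * Y t \<omega>))"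
      unfolding P'_def Q'_def V_def[symmetric] W_def[symmetric]
      by (subst split[OF P.finite_measure_axioms]; simp?) (subst split[OF Q.finite_measure_axioms]; simp add: 4 5)
    show "\<And>t. t \<in> J \<Longrightarrow> A t \<in> sets borel" by simp
  qed
  with P' Q' show ?case by simp
qed

subsection \<open>Gaussian linear combinations\<close>

context
  fixes m s :: real
  assumes s_nonneg: "s \<ge> 0"
begin

text \<open>As an affine image of the standard normal law the degenerate case needs no separate
  treatment, so characteristic function and moments are computed once for all
  \<open>s\<close>.\<close>

lemma normal_law_eq_distr:
  "normal_law m s = distr std_normal_distribution borel (\<lambda>x. m + s * x)"
proof (cases "s = 0")
  case True
  interpret std: prob_space std_normal_distribution by (rule prob_space_normal_density) simp
  show ?thesis
    using True std.distr_const[of m borel] by (simp add: normal_law_def)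
next
  case False
  then have "s > 0" using s_nonneg by simp
  interpret std: prob_space std_normal_distribution by (rule prob_space_normal_density) simp
  have "distributed std_normal_distribution lborel (\<lambda>x. x) std_normal_density"
    by (simp add: distributed_def distr_id2)
  from std.normal_density_affine[OF this, of s m] \<open>s > 0\<close>
  have "distr std_normal_distribution lborel (\<lambda>x. m + s * x) = density lborel (normal_density m s)"
    by (simp add: distributed_def)
  moreover have "distr std_normal_distribution lborel (\<lambda>x. m + s * x) = distr std_normal_distribution borel (\<lambda>x. m + s * x)"
    by (intro distr_cong) auto
  ultimately show ?thesis
    using False by (simp add: normal_law_def)
qed

lemma char_normal_law: "char (normal_law m s) t = exp (\<i> * (t * m) - (s * t)\<^sup>2 / 2)"
proof -
  have "char (normal_law m s) t = (CLINT x|std_normal_distribution. iexp (t * m) * iexp ((s * t) * x))"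
    unfolding normal_law_eq_distr char_def
    by (subst integral_distr) (simp_all add: algebra_simps flip: exp_add)
  also have "\<dots> = iexp (t * m) * char std_normal_distribution (s * t)"
    by (simp add: char_def)
  also have "\<dots> = iexp (t * m) * exp (- ((s * t)\<^sup>2 / 2))"
    by (simp add: char_std_normal_distribution flip: exp_of_real)
  also have "\<dots> = exp (\<i> * (t * m) - (s * t)\<^sup>2 / 2)"
    by (simp only: exp_of_real[symmetric] exp_add[symmetric]) simp
  finally show ?thesis .
qed

lemma normal_law_moments:
  "integrable (normal_law m s) (\<lambda>x. x\<^sup>2)"
  "(\<integral>x. x \<partial>normal_law m s) = m" "(\<integral>x. (x - m)\<^sup>2 \<partial>normal_law m s) = s\<^sup>2"
proof -
  interpret std: prob_space std_normal_distribution by (rule prob_space_normal_density) simp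
  have i: "integrable std_normal_distribution (\<lambda>x. x ^ k)" for k
    using integrable_std_normal_moment[of k] by (simp add: integrable_density)
  note i1 = i[of 1, simplified] and i2 = i[of 2]
  have m1: "(\<integral>x. x \<partial>std_normal_distribution) = 0"
    using integral_std_normal_moment_odd[of 0] by (simp add: integral_density)
  have m2: "(\<integral>x. x\<^sup>2 \<partial>std_normal_distribution) = 1"
    using integral_std_normal_moment_even[of 1] by (simp add: integral_density)
  have eq: "(m + s * x)\<^sup>2 = m\<^sup>2 + 2 * m * s * x + s\<^sup>2 * x\<^sup>2" for x
    by (simp add: power2_eq_square algebra_simps)
  show "integrable (normal_law m s) (\<lambda>x. x\<^sup>2)"
    unfolding normal_law_eq_distr by (subst integrable_distr_eq) (auto simp: eq i1 i2)
  show "(\<integral>x. x \<partial>normal_law m s) = m"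
    unfolding normal_law_eq_distr
    by (subst integral_distr) (auto simp: i1 m1 std.prob_space[simplified])
  show "(\<integral>x. (x - m)\<^sup>2 \<partial>normal_law m s) = s\<^sup>2"
    unfolding normal_law_eq_distr by (subst integral_distr) (auto simp: power_mult_distrib m2)
qed

end

text \<open>The density is at most 1 / (s sqrt(2 pi)), which is rounded up to 1 / s. Only the linear
  dependence on the length matters: length 0 excludes atoms, and small lengths give
  anti-concentration.\<close>

lemma emeasure_normal_law_Icc_le:
  assumes "s > 0" "a \<le> b"
  shows "emeasure (normal_law m s) {a..b} \<le> ennreal ((b - a) / s)"
proof -
  have le: "normal_density m s x \<le> 1 / s" for x
  proof -
    have "1 \<le> sqrt (2 * pi)"
      using pi_gt3 by (simp add: real_le_rsqrt)
    then have "1 / sqrt (2 * pi * s\<^sup>2) \<le> 1 / s"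
      using \<open>s > 0\<close> by (simp add: real_sqrt_mult field_simps)
    moreover have "exp (- (x - m)\<^sup>2 / (2 * s\<^sup>2)) \<le> 1" by simp
    ultimately show ?thesis
      unfolding normal_density_def using \<open>s > 0\<close>
      using mult_mono[of "1 / sqrt (2 * pi * s\<^sup>2)" "1 / s" "exp (- (x - m)\<^sup>2 / (2 * s\<^sup>2))" 1] by simp
  qed
  have "emeasure (normal_law m s) {a..b} = (\<integral>\<^sup>+x. ennreal (normal_density m s x) * indicator {a..b} x \<partial>lborel)"
    using \<open>s > 0\<close> by (simp add: normal_law_def emeasure_density)
  also have "\<dots> \<le> (\<integral>\<^sup>+x. ennreal (1 / s) * indicator {a..b} x \<partial>lborel)"
    by (intro nn_integral_mono mult_right_mono ennreal_leI le) simp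
  also have "\<dots> = ennreal ((b - a) / s)"
    using assms by (simp add: nn_integral_cmult_indicator ennreal_mult[symmetric])
  finally show ?thesis .
qed

text \<open>The class on which \<open>covariance\<close> is bilinear. The Bochner integral of a
  non-integrable function is 0 by convention, so the algebraic rules require that all products
  involved are integrable.\<close>

definition square_integrable :: "'a measure \<Rightarrow> ('a \<Rightarrow> real) \<Rightarrow> bool" where
  "square_integrable M X \<longleftrightarrow> X \<in> borel_measurable M \<and> integrable M (\<lambda>\<omega>. (X \<omega>)\<^sup>2)"

lemma square_integrable_mult:
  assumes "square_integrable M X" "square_integrable M Y"
  shows "integrable M (\<lambda>\<omega>. X \<omega> * Y \<omega>)"
proof (rule Bochner_Integration.integrable_bound)
  show "integrable M (\<lambda>\<omega>. (X \<omega>)\<^sup>2 + (Y \<omega>)\<^sup>2)"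
    using assms by (simp add: square_integrable_def)
  show "(\<lambda>\<omega>. X \<omega> * Y \<omega>) \<in> borel_measurable M"
    using assms by (auto simp: square_integrable_def)
  have "\<bar>x * y\<bar> \<le> x\<^sup>2 + y\<^sup>2" for x y :: real
  proof -
    have "2 * (\<bar>x\<bar> * \<bar>y\<bar>) \<le> \<bar>x\<bar>\<^sup>2 + \<bar>y\<bar>\<^sup>2"
      using sum_squares_bound[of "\<bar>x\<bar>" "\<bar>y\<bar>"] by simp
    moreover have "0 \<le> \<bar>x\<bar> * \<bar>y\<bar>" by simp
    ultimately show ?thesis unfolding abs_mult power2_abs by linarith
  qed
  then show "AE \<omega> in M. norm (X \<omega> * Y \<omega>) \<le> norm ((X \<omega>)\<^sup>2 + (Y \<omega>)\<^sup>2)"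
    by simp
qed

lemma square_integrable_add:
  assumes "square_integrable M X" "square_integrable M Y"
  shows "square_integrable M (\<lambda>\<omega>. X \<omega> + Y \<omega>)"
  using assms square_integrable_mult[OF assms]
  by (auto simp: square_integrable_def power2_sum mult.assoc)

lemma square_integrable_scale:
  "square_integrable M X \<Longrightarrow> square_integrable M (\<lambda>\<omega>. c * X \<omega>)"
  by (auto simp: square_integrable_def power_mult_distrib)

lemma covariance_commute: "covariance M X Y = covariance M Y X"
  by (simp add: covariance_def mult.commute)

context prob_space
begin

lemma square_integrable_integrable: "square_integrable M X \<Longrightarrow> integrable M X"
  by (auto simp: square_integrable_def intro: square_integrable_imp_integrable)

lemma square_integrable_const: "square_integrable M (\<lambda>_. c)"
  by (simp add: square_integrable_def)

lemma covariance_eq: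
  assumes "square_integrable M X" "square_integrable M Y"
  shows "covariance M X Y = expectation (\<lambda>\<omega>. X \<omega> * Y \<omega>) - expectation X * expectation Y"
proof -
  have "covariance M X Y = expectation (\<lambda>\<omega>. X \<omega> * Y \<omega> - expectation Y * X \<omega> - expectation X * Y \<omega> + expectation X * expectation Y)"
    unfolding covariance_def by (intro Bochner_Integration.integral_cong) (auto simp: algebra_simps)
  then show ?thesis
    using assms by (simp add: square_integrable_mult square_integrable_integrable prob_space)
qed

lemma covariance_add_left:
  assumes "square_integrable M X" "square_integrable M Y" "square_integrable M Z"
  shows "covariance M (\<lambda>\<omega>. X \<omega> + Y \<omega>) Z = covariance M X Z + covariance M Y Z"
  using assms by (simp add: covariance_eq square_integrable_add distrib_right square_integrable_mult square_integrable_integrable)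

lemma covariance_scale_left:
  assumes "square_integrable M X" "square_integrable M Z"
  shows "covariance M (\<lambda>\<omega>. c * X \<omega>) Z = c * covariance M X Z"
  using assms by (simp add: covariance_eq square_integrable_scale mult.assoc square_integrable_mult square_integrable_integrable right_diff_distrib)

end

section \<open>Linear combinations of a Gaussian process\<close>

definition linear_span :: "('t \<Rightarrow> 'a \<Rightarrow> real) \<Rightarrow> ('a \<Rightarrow> real) set" where
  "linear_span X = {Y. \<exists>J a. finite J \<and> Y = (\<lambda>\<omega>. \<Sum>t\<in>J. a t * X t \<omega>)}"

lemma linear_spanI: "finite J \<Longrightarrow> (\<lambda>\<omega>. \<Sum>t\<in>J. a t * X t \<omega>) \<in> linear_span X"
  by (auto simp: linear_span_def)

lemma linear_span_base: "X t \<in> linear_span X"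
  using linear_spanI[of "{t}" "\<lambda>_. 1" X] by simp

lemma linear_span_scale:
  assumes "Y \<in> linear_span X"
  shows "(\<lambda>\<omega>. c * Y \<omega>) \<in> linear_span X"
proof -
  obtain J a where "finite J" "Y = (\<lambda>\<omega>. \<Sum>t\<in>J. a t * X t \<omega>)"
    using assms by (auto simp: linear_span_def)
  then show ?thesis
    using linear_spanI[of J "\<lambda>t. c * a t" X] by (simp add: sum_distrib_left mult.assoc)
qed

lemma linear_span_add:
  assumes "Y \<in> linear_span X" "Z \<in> linear_span X"
  shows "(\<lambda>\<omega>. Y \<omega> + Z \<omega>) \<in> linear_span X"
proof -
  obtain J a where J: "finite J" "Y = (\<lambda>\<omega>. \<Sum>t\<in>J. a t * X t \<omega>)"
    using assms by (auto simp: linear_span_def)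
  obtain K b where K: "finite K" "Z = (\<lambda>\<omega>. \<Sum>t\<in>K. b t * X t \<omega>)"
    using assms by (auto simp: linear_span_def)
  define a' b' where "a' t = (if t \<in> J then a t else 0)" and "b' t = (if t \<in> K then b t else 0)" for t
  have "Y = (\<lambda>\<omega>. \<Sum>t\<in>J \<union> K. a' t * X t \<omega>)" "Z = (\<lambda>\<omega>. \<Sum>t\<in>J \<union> K. b' t * X t \<omega>)"
    using J(1) K(1) unfolding J(2) K(2) a'_def b'_def
    by (auto intro!: ext sum.mono_neutral_cong_left)
  then have "(\<lambda>\<omega>. Y \<omega> + Z \<omega>) = (\<lambda>\<omega>. \<Sum>t\<in>J \<union> K. (a' t + b' t) * X t \<omega>)"
    by (simp add: sum.distrib distrib_right)
  then show ?thesis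
    using J(1) K(1) linear_spanI[of "J \<union> K"] by simp
qed

lemma linear_span_diff:
  assumes "Y \<in> linear_span X" "Z \<in> linear_span X"
  shows "(\<lambda>\<omega>. Y \<omega> - Z \<omega>) \<in> linear_span X"
  using linear_span_add[OF assms(1) linear_span_scale[OF assms(2), of "-1"]] by simp

locale gaussian = prob_space M for M :: "'a measure" +
  fixes X :: "'t \<Rightarrow> 'a \<Rightarrow> real"
  assumes gaussian: "gaussian_process M X"
begin

lemma random_variable [measurable]: "X t \<in> borel_measurable M"
  using gaussian by (simp add: gaussian_process_def)

lemma linear_span_measurable: "Y \<in> linear_span X \<Longrightarrow> Y \<in> borel_measurable M"
  by (auto simp: linear_span_def)

text \<open>\<open>gaussian_process\<close> provides some parameters of a normal law for each
  combination; comparing moments identifies them. From here on mean and covariance determine the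
  law.\<close>

lemma linear_span_law:
  assumes "Y \<in> linear_span X"
  shows "square_integrable M Y" "covariance M Y Y \<ge> 0"
    "distr M borel Y = normal_law (expectation Y) (sqrt (covariance M Y Y))"
proof -
  have [measurable]: "Y \<in> borel_measurable M"
    using assms by (rule linear_span_measurable)
  obtain J a where "finite J" "Y = (\<lambda>\<omega>. \<Sum>t\<in>J. a t * X t \<omega>)"
    using assms by (auto simp: linear_span_def)
  then have "\<exists>m s. 0 \<le> s \<and> distr M borel Y = normal_law m s"
    using gaussian unfolding gaussian_process_def by blast
  then obtain m s where s: "s \<ge> 0" and law: "distr M borel Y = normal_law m s"
    by blast
  note mom = normal_law_moments[OF s, of m, folded law]
  show L2: "square_integrable M Y"
    using mom(1) by (simp add: square_integrable_def integrable_distr_eq)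
  have m: "expectation Y = m"
    using mom(2) by (simp add: integral_distr)
  have v: "covariance M Y Y = s\<^sup>2"
    using mom(3) by (simp add: integral_distr covariance_def m power2_eq_square)
  then show "covariance M Y Y \<ge> 0" by simp
  show "distr M borel Y = normal_law (expectation Y) (sqrt (covariance M Y Y))"
    using s by (simp add: m v law)
qed

lemma linear_span_char:
  assumes "Y \<in> linear_span X"
  shows "(CLINT \<omega>|M. iexp (Y \<omega>)) = exp (\<i> * expectation Y - covariance M Y Y / 2)"
proof -
  have [measurable]: "Y \<in> borel_measurable M"
    using assms by (rule linear_span_measurable)
  have "(CLINT \<omega>|M. iexp (Y \<omega>)) = char (distr M borel Y) 1"
    by (simp add: char_def integral_distr)
  also have "\<dots> = exp (\<i> * expectation Y - covariance M Y Y / 2)"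
    using linear_span_law[OF assms] by (simp add: char_normal_law flip: of_real_power)
  finally show ?thesis .
qed

lemma linear_span_prob_Icc_le:
  assumes "Y \<in> linear_span X" "covariance M Y Y > 0" "a \<le> b"
  shows "prob {\<omega>\<in>space M. Y \<omega> \<in> {a..b}} \<le> (b - a) / sqrt (covariance M Y Y)"
proof -
  have [measurable]: "Y \<in> borel_measurable M"
    using assms(1) by (rule linear_span_measurable)
  have "emeasure M {\<omega>\<in>space M. Y \<omega> \<in> {a..b}} = emeasure (distr M borel Y) {a..b}"
    by (simp add: emeasure_distr vimage_def Int_def conj_commute)
  also have "\<dots> \<le> ennreal ((b - a) / sqrt (covariance M Y Y))"
    using assms unfolding linear_span_law(3)[OF assms(1)]
    by (intro emeasure_normal_law_Icc_le) auto
  finally show ?thesis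
    using assms by (simp add: emeasure_eq_measure)
qed

end

subsection \<open>Resampling an increment\<close>

context gaussian
begin

text \<open>
  The process \<open>X t - \<kappa> t * N\<close> is uncorrelated with, hence independent of, \<open>N\<close>; so \<open>N\<close> may be replaced
  by an independent copy.
\<close>

lemma path_law_resample:
  assumes N: "N \<in> linear_span X"
    and \<kappa>: "\<And>t. t \<in> I \<Longrightarrow> covariance M (X t) N = \<kappa> t * covariance M N N"
  shows "distr M (\<Pi>\<^sub>M t\<in>I. borel) (\<lambda>\<omega>. \<lambda>t\<in>I. X t \<omega>)
    = distr (M \<Otimes>\<^sub>M M) (\<Pi>\<^sub>M t\<in>I. borel) (\<lambda>z. \<lambda>t\<in>I. X t (fst z) - \<kappa> t * N (fst z) + \<kappa> t * N (snd z))"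
proof -
  interpret MM: pair_prob_space M M ..
  have [measurable]: "N \<in> borel_measurable M"
    using N by (rule linear_span_measurable)
  define H where "H t z = X t (fst z) - \<kappa> t * N (fst z) + \<kappa> t * N (snd z)" for t z
  have [measurable]: "H t \<in> borel_measurable (M \<Otimes>\<^sub>M M)" for t
    by (simp add: H_def[abs_def])
  have "distr M (\<Pi>\<^sub>M t\<in>I. borel) (\<lambda>\<omega>. \<lambda>t\<in>I. X t \<omega>) = distr (M \<Otimes>\<^sub>M M) (\<Pi>\<^sub>M t\<in>I. borel) (\<lambda>z. \<lambda>t\<in>I. H t z)"
  proof (rule measure_eqI_PiM_infinite)
    fix A J assume J: "finite J" "J \<subseteq> I" and A: "\<And>t. t \<in> J \<Longrightarrow> A t \<in> sets (borel :: real measure)"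
    have emb: "emeasure (distr K (\<Pi>\<^sub>M t\<in>I. borel) (\<lambda>\<omega>. \<lambda>t\<in>I. Z t \<omega>)) (prod_emb I (\<lambda>_. borel) J (Pi\<^sub>E J A))
        = emeasure K {\<omega>\<in>space K. \<forall>t\<in>J. Z t \<omega> \<in> A t}"
      if [measurable]: "\<And>t. Z t \<in> borel_measurable K" for K :: "'b measure" and Z :: "'t \<Rightarrow> 'b \<Rightarrow> real"
    proof (subst emeasure_distr)
      show "prod_emb I (\<lambda>_. borel) J (Pi\<^sub>E J A) \<in> sets (\<Pi>\<^sub>M t\<in>I. borel)"
        using J A by (intro sets_PiM_I) auto
      show "emeasure K ((\<lambda>\<omega>. \<lambda>t\<in>I. Z t \<omega>) -` prod_emb I (\<lambda>_. borel) J (Pi\<^sub>E J A) \<inter> space K)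
          = emeasure K {\<omega>\<in>space K. \<forall>t\<in>J. Z t \<omega> \<in> A t}"
        using J by (intro arg_cong2[where f = emeasure]) (auto simp: prod_emb_def PiE_iff subset_eq extensional_def)
    qed simp
    have "measure M {\<omega>\<in>space M. \<forall>t\<in>J. X t \<omega> \<in> A t}
        = measure (M \<Otimes>\<^sub>M M) {z\<in>space (M \<Otimes>\<^sub>M M). \<forall>t\<in>J. H t z \<in> A t}"
    proof (rule finite_dimensional_eq_if_char_eq)
      fix a
      define Y where "Y \<omega> = (\<Sum>t\<in>J. a t * X t \<omega>)" for \<omega>
      define k where "k = (\<Sum>t\<in>J. a t * \<kappa> t)"
      \<comment> \<open>The residual of the linear regression of \<open>Y\<close> on
        \<open>N\<close>; the coefficient \<open>k\<close> is chosen so that \<open>U\<close> and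
        \<open>N\<close> are uncorrelated.\<close>
      define U where "U \<omega> = Y \<omega> - k * N \<omega>" for \<omega>
      have Y: "Y \<in> linear_span X"
        using J linear_spanI[of J a X] by (simp add: Y_def[abs_def])
      have U: "U \<in> linear_span X"
        unfolding U_def[abs_def] using Y N by (intro linear_span_diff linear_span_scale)
      have kN: "(\<lambda>\<omega>. k * N \<omega>) \<in> linear_span X"
        using N by (rule linear_span_scale)
      have [measurable]: "U \<in> borel_measurable M"
        using U by (rule linear_span_measurable)
      note L2 = linear_span_law(1)
      have "covariance M Y N = k * covariance M N N"
        using J(1,2) L2[OF N] \<kappa> unfolding Y_def[abs_def] k_def
      proof (induction J)
        case empty
        then show ?case by (simp add: covariance_def)
      next
        case (insert t J)
        have "covariance M (\<lambda>\<omega>. a t * X t \<omega> + (\<Sum>t\<in>J. a t * X t \<omega>)) N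
            = a t * covariance M (X t) N + covariance M (\<lambda>\<omega>. \<Sum>t\<in>J. a t * X t \<omega>) N"
          using insert.hyps(1) insert.prems
          by (subst covariance_add_left)
            (auto simp: covariance_scale_left L2 linear_span_base linear_span_scale linear_spanI)
        with insert show ?case by (simp add: distrib_right)
      qed
      moreover have "Y = (\<lambda>\<omega>. U \<omega> + k * N \<omega>)"
        by (simp add: U_def)
      then have split: "covariance M Y Z = covariance M U Z + k * covariance M N Z" if "Z \<in> linear_span X" for Z
        using that U N kN by (simp add: covariance_add_left covariance_scale_left L2)
      ultimately have UN: "covariance M U N = 0"
        using split[OF N] by simp
      have var: "covariance M Y Y = covariance M U U + k\<^sup>2 * covariance M N N"
        using split[OF Y] split[OF U] split[OF N] UN
          covariance_commute[of M U Y] covariance_commute[of M N U] covariance_commute[of M N Y]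
        by (simp add: power2_eq_square)
      have vark: "covariance M (\<lambda>\<omega>. k * N \<omega>) (\<lambda>\<omega>. k * N \<omega>) = k\<^sup>2 * covariance M N N"
        using L2[OF N] square_integrable_scale[OF L2[OF N], of k] covariance_commute[of M N "\<lambda>\<omega>. k * N \<omega>"]
        by (simp add: covariance_scale_left power2_eq_square)
      have mean: "expectation Y = expectation U + k * expectation N"
        using square_integrable_integrable[OF L2[OF Y]] square_integrable_integrable[OF L2[OF N]]
        by (simp add: U_def[abs_def])
      have int: "complex_integrable (M \<Otimes>\<^sub>M M) (\<lambda>z. iexp (U (fst z)) * iexp (k * N (snd z)))"
        by (intro MM.P.integrable_const_bound[of _ 1]) (auto simp: norm_mult simp del: of_real_mult)
      \<comment> \<open>Independence of \<open>U\<close> and \<open>N\<close> enters only in this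
        form: means and variances add, so the characteristic function factorizes, and the product is
        an integral over two independent copies of the space.\<close>
      have "(CLINT \<omega>|M. iexp (Y \<omega>)) = (CLINT \<omega>|M. iexp (U \<omega>)) * (CLINT \<omega>|M. iexp (k * N \<omega>))"
        unfolding linear_span_char[OF Y] linear_span_char[OF U] linear_span_char[OF kN]
        by (simp add: mean var vark algebra_simps add_divide_distrib flip: exp_add)
      also have "\<dots> = (CLINT \<omega>|M. (CLINT \<omega>'|M. iexp (U \<omega>) * iexp (k * N \<omega>')))"
        by simp
      also have "\<dots> = (CLINT z|M \<Otimes>\<^sub>M M. iexp (U (fst z)) * iexp (k * N (snd z)))"
        using MM.integral_fst'[OF int] by simp
      also have "\<dots> = (CLINT z|M \<Otimes>\<^sub>M M. iexp (\<Sum>t\<in>J. a t * H t z))"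
      proof (rule arg_cong[where f = "\<lambda>f. integral\<^sup>L (M \<Otimes>\<^sub>M M) f"], rule ext)
        fix z :: "'a \<times> 'a"
        have "(\<Sum>t\<in>J. a t * H t z) = U (fst z) + k * N (snd z)"
          by (simp add: H_def U_def Y_def k_def algebra_simps sum.distrib sum_subtractf sum_distrib_left)
        then show "iexp (U (fst z)) * iexp (k * N (snd z)) = iexp (\<Sum>t\<in>J. a t * H t z)"
          by (simp only: of_real_add distrib_left exp_add)
      qed
      finally show "(CLINT \<omega>|M. iexp (\<Sum>t\<in>J. a t * X t \<omega>)) = (CLINT z|M \<Otimes>\<^sub>M M. iexp (\<Sum>t\<in>J. a t * H t z))"
        by (simp only: Y_def)
    qed (use J A in \<open>auto intro: finite_measure_axioms MM.P.finite_measure_axioms\<close>)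
    then show "emeasure (distr M (\<Pi>\<^sub>M t\<in>I. borel) (\<lambda>\<omega>. \<lambda>t\<in>I. X t \<omega>)) (prod_emb I (\<lambda>_. borel) J (Pi\<^sub>E J A))
        = emeasure (distr (M \<Otimes>\<^sub>M M) (\<Pi>\<^sub>M t\<in>I. borel) (\<lambda>z. \<lambda>t\<in>I. H t z)) (prod_emb I (\<lambda>_. borel) J (Pi\<^sub>E J A))"
      by (simp add: emb emeasure_eq_measure MM.P.emeasure_eq_measure)
  next
    show "finite_measure (distr M (\<Pi>\<^sub>M t\<in>I. borel) (\<lambda>\<omega>. \<lambda>t\<in>I. X t \<omega>))"
      by (intro finite_measure_distr) simp
  qed simp_all
  then show ?thesis by (simp add: H_def)
qed

text \<open>After resampling, the supremum over \<open>L\<close> moves by k times the fresh copy of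
  \<open>N\<close> and the one over \<open>R\<close> by k + 1 times it. With the first coordinate
  frozen, a finite tie therefore pins the fresh copy to a single value, which a nondegenerate normal
  variable takes with probability 0; Fubini concludes. An infinite common supremum does not react to
  finite shifts, hence the exception. Countability of \<open>L\<close> and \<open>R\<close> makes
  the tie a measurable event of the path.\<close>

lemma AE_suprema_distinct:
  assumes N: "N \<in> linear_span X" "covariance M N N > 0"
    and LR: "countable L" "countable R" "L \<noteq> {}" "R \<noteq> {}"
    and L: "\<And>t. t \<in> L \<Longrightarrow> covariance M (X t) N = k * covariance M N N"
    and R: "\<And>t. t \<in> R \<Longrightarrow> covariance M (X t) N = (k + 1) * covariance M N N"
  shows "AE \<omega> in M. (SUP t\<in>L. ereal (X t \<omega>)) = (SUP t\<in>R. ereal (X t \<omega>)) \<longrightarrow> \<bar>SUP t\<in>L. ereal (X t \<omega>)\<bar> = \<infinity>"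
proof -
  interpret MM: pair_prob_space M M ..
  have [measurable]: "N \<in> borel_measurable M"
    using N(1) by (rule linear_span_measurable)
  define I where "I = L \<union> R"
  define \<kappa> where "\<kappa> t = (if t \<in> L then k else k + 1)" for t
  \<comment> \<open>A common index would have both coefficients, impossible for positive variance.
    Hence \<open>\<kappa>\<close> is k + 1 on all of \<open>R\<close>.\<close>
  have disj: "t \<notin> L" if "t \<in> R" for t
    using L[of t] R[of t] that N(2) by auto
  define tie where "tie g \<longleftrightarrow> (SUP t\<in>L. ereal (g t)) = (SUP t\<in>R. ereal (g t)) \<and> \<bar>SUP t\<in>L. ereal (g t)\<bar> \<noteq> \<infinity>"
    for g :: "'t \<Rightarrow> real"
  define E where "E = {g\<in>space (\<Pi>\<^sub>M t\<in>I. borel). tie g}"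
  have tie_sets: "{x\<in>space K. tie (f x)} \<in> sets K"
    if [measurable]: "\<And>t. t \<in> I \<Longrightarrow> (\<lambda>x. f x t) \<in> borel_measurable K" for K :: "'b measure" and f
  proof -
    define SL SR where "SL x = (SUP t\<in>L. ereal (f x t))" and "SR x = (SUP t\<in>R. ereal (f x t))" for x
    have [measurable]: "SL \<in> borel_measurable K" "SR \<in> borel_measurable K"
      unfolding SL_def[abs_def] SR_def[abs_def] using LR(1,2) by (auto intro!: borel_measurable_SUP simp: I_def)
    have "{x\<in>space K. SL x = SR x \<and> \<bar>SL x\<bar> \<noteq> \<infinity>} \<in> sets K"
      by measurable
    then show ?thesis by (simp add: tie_def SL_def SR_def)
  qed
  have E [measurable]: "E \<in> sets (\<Pi>\<^sub>M t\<in>I. borel)"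
    unfolding E_def by (rule tie_sets) (rule measurable_component_singleton)
  define H where "H z = (\<lambda>t\<in>I. X t (fst z) - \<kappa> t * N (fst z) + \<kappa> t * N (snd z))" for z
  have H [measurable]: "H \<in> M \<Otimes>\<^sub>M M \<rightarrow>\<^sub>M (\<Pi>\<^sub>M t\<in>I. borel)"
    unfolding H_def[abs_def] by simp
  have restrict: "tie (\<lambda>t\<in>I. f t) = tie f" for f
    unfolding tie_def by (simp add: I_def cong: SUP_cong)
  have "emeasure M {\<omega>\<in>space M. tie (\<lambda>t. X t \<omega>)} = emeasure (distr M (\<Pi>\<^sub>M t\<in>I. borel) (\<lambda>\<omega>. \<lambda>t\<in>I. X t \<omega>)) E"
  proof (subst emeasure_distr)
    have "(\<lambda>\<omega>. \<lambda>t\<in>I. X t \<omega>) -` E \<inter> space M = {\<omega>\<in>space M. tie (\<lambda>t. X t \<omega>)}"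
      by (auto simp: E_def restrict space_PiM)
    then show "emeasure M {\<omega>\<in>space M. tie (\<lambda>t. X t \<omega>)} = emeasure M ((\<lambda>\<omega>. \<lambda>t\<in>I. X t \<omega>) -` E \<inter> space M)"
      by simp
  qed (simp_all add: E)
  also have "distr M (\<Pi>\<^sub>M t\<in>I. borel) (\<lambda>\<omega>. \<lambda>t\<in>I. X t \<omega>) = distr (M \<Otimes>\<^sub>M M) (\<Pi>\<^sub>M t\<in>I. borel) H"
    unfolding H_def[abs_def] using L R disj N(1)
    by (intro path_law_resample) (auto simp: I_def \<kappa>_def)
  also have "emeasure (distr (M \<Otimes>\<^sub>M M) (\<Pi>\<^sub>M t\<in>I. borel) H) E
      = emeasure (M \<Otimes>\<^sub>M M) (H -` E \<inter> space (M \<Otimes>\<^sub>M M))"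
    by (intro emeasure_distr) simp_all
  also have "\<dots> = (\<integral>\<^sup>+\<omega>. emeasure M (Pair \<omega> -` (H -` E \<inter> space (M \<Otimes>\<^sub>M M))) \<partial>M)"
    by (intro emeasure_pair_measure_alt) measurable
  also have "\<dots> = (\<integral>\<^sup>+\<omega>. 0 \<partial>M)"
  proof (rule nn_integral_cong)
    fix \<omega> assume "\<omega> \<in> space M"
    define h where "h t = X t \<omega> - \<kappa> t * N \<omega>" for t
    \<comment> \<open>Solving SUP_L + k N = SUP_R + (k + 1) N for N. In a finite tie both suprema of
      \<open>h\<close> are finite, so \<open>real_of_ereal\<close> loses nothing there.\<close>
    define c where "c = real_of_ereal (SUP t\<in>L. ereal (h t)) - real_of_ereal (SUP t\<in>R. ereal (h t))"
    have "N \<omega>' = c" if "H (\<omega>, \<omega>') \<in> E" for \<omega>'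
    proof -
      from that have "tie (\<lambda>t. h t + \<kappa> t * N \<omega>')"
        by (simp add: E_def H_def restrict h_def)
      moreover have "(SUP t\<in>L. ereal (h t + \<kappa> t * N \<omega>')) = (SUP t\<in>L. ereal (h t)) + ereal (k * N \<omega>')"
        using LR(3) by (subst SUP_ereal_add_left[symmetric]) (auto simp: \<kappa>_def intro!: SUP_cong)
      moreover have "(SUP t\<in>R. ereal (h t + \<kappa> t * N \<omega>')) = (SUP t\<in>R. ereal (h t)) + ereal ((k + 1) * N \<omega>')"
        using LR(4) disj by (subst SUP_ereal_add_left[symmetric]) (auto simp: \<kappa>_def intro!: SUP_cong)
      ultimately show ?thesis
        unfolding tie_def c_def
        by (cases "SUP t\<in>L. ereal (h t)"; cases "SUP t\<in>R. ereal (h t)") (auto simp: algebra_simps)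
    qed
    then have "emeasure M (Pair \<omega> -` (H -` E \<inter> space (M \<Otimes>\<^sub>M M))) \<le> emeasure M {\<omega>'\<in>space M. N \<omega>' \<in> {c..c}}"
      by (intro emeasure_mono) (auto simp: space_pair_measure)
    also have "\<dots> = 0"
      using linear_span_prob_Icc_le[OF N, of c c] by (simp add: emeasure_eq_measure measure_le_0_iff)
    finally show "emeasure M (Pair \<omega> -` (H -` E \<inter> space (M \<Otimes>\<^sub>M M))) = 0" by simp
  qed
  finally have "emeasure M {\<omega>\<in>space M. tie (\<lambda>t. X t \<omega>)} = 0" by simp
  moreover have "{\<omega>\<in>space M. tie (\<lambda>t. X t \<omega>)} \<in> sets M"
    by (intro tie_sets) simp
  ultimately have "AE \<omega> in M. \<not> tie (\<lambda>t. X t \<omega>)"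
    by (intro AE_I'[of "{\<omega>\<in>space M. tie (\<lambda>t. X t \<omega>)}"]) auto
  then show ?thesis
    by eventually_elim (auto simp: tie_def)
qed

end

subsection \<open>Increments of Brownian motion with drift\<close>

lemma sum_half_power_le: "(\<Sum>k<K. (1 / 2 :: real) ^ k) \<le> 2"
proof -
  have "(\<Sum>k<K. (1 / 2 :: real) ^ k) = 2 - 2 * (1 / 2) ^ K"
    by (induction K) (auto simp: field_simps)
  then show ?thesis by simp
qed

text \<open>Subtraction on \<open>nat\<close> is truncated, so the exponent is the distance of n and
  m. Splitting at n leaves two geometric series of sum at most 2 each, uniformly in n and K.\<close>

lemma sum_half_power_dist_le: "(\<Sum>m<K. (1 / 2 :: real) ^ ((n - m) + (m - n))) \<le> 4"
proof -
  have "(\<Sum>m<K. (1 / 2 :: real) ^ ((n - m) + (m - n))) \<le> (\<Sum>m<n + K. (1 / 2) ^ ((n - m) + (m - n)))"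
    by (intro sum_mono2) auto
  also have "\<dots> = (\<Sum>m<n. (1 / 2) ^ (n - m)) + (\<Sum>m = n..<n + K. (1 / 2) ^ (m - n))"
    using sum.atLeastLessThan_concat[of 0 n "n + K" "\<lambda>m. (1 / 2 :: real) ^ ((n - m) + (m - n))"]
    by (simp add: lessThan_atLeast0)
  also have "(\<Sum>m<n. (1 / 2 :: real) ^ (n - m)) = (\<Sum>m<n. (1 / 2) ^ Suc m)"
    by (subst sum.nat_diff_reindex[symmetric]) (intro sum.cong, auto)
  also have "\<dots> \<le> (\<Sum>m<n. (1 / 2) ^ m)"
    by (intro sum_mono) simp
  also have "\<dots> \<le> 2" by (rule sum_half_power_le)
  also have "(\<Sum>m = n..<n + K. (1 / 2 :: real) ^ (m - n)) = (\<Sum>k<K. (1 / 2) ^ k)"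
    by (rule sum.reindex_bij_witness[of _ "\<lambda>k. n + k" "\<lambda>m. m - n"]) auto
  also have "\<dots> \<le> 2" by (rule sum_half_power_le)
  finally show ?thesis by simp
qed

context gaussian
begin

lemma covariance_diff_left:
  assumes "Y \<in> linear_span X" "Z \<in> linear_span X" "W \<in> linear_span X"
  shows "covariance M (\<lambda>\<omega>. Y \<omega> - Z \<omega>) W = covariance M Y W - covariance M Z W"
proof -
  have "covariance M (\<lambda>\<omega>. Y \<omega> + (-1) * Z \<omega>) W = covariance M Y W + (-1) * covariance M Z W"
    using assms by (simp only: covariance_add_left covariance_scale_left linear_span_law(1) linear_span_scale)
  then show ?thesis by simp
qed

lemma covariance_diff_right:
  assumes "Y \<in> linear_span X" "Z \<in> linear_span X" "W \<in> linear_span X"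
  shows "covariance M W (\<lambda>\<omega>. Y \<omega> - Z \<omega>) = covariance M W Y - covariance M W Z"
  using covariance_diff_left[OF assms] by (simp add: covariance_commute)

text \<open>
  On the event \<open>E\<close> that all \<open>Z n\<close> are nonpositive, anti-concentration keeps the integrals of \<open>Z n\<close>
  over \<open>E\<close> below a negative constant, while the decay of correlations makes their averages
  tend to zero.
\<close>

lemma prob_all_nonpos_eq_0:
  assumes Z: "\<And>n. Z n \<in> linear_span X"
    and cov: "\<And>n m. covariance M (Z n) (Z m) = (1 / 2) ^ ((n - m) + (m - n))"
    and mean: "(\<lambda>n. expectation (Z n)) \<longlonglongrightarrow> 0"
  shows "prob {\<omega>\<in>space M. \<forall>n::nat. Z n \<omega> \<le> 0} = 0"
proof (rule ccontr)
  define E where "E = {\<omega>\<in>space M. \<forall>n. Z n \<omega> \<le> 0}"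
  define p where "p = prob E"
  assume "prob {\<omega>\<in>space M. \<forall>n. Z n \<omega> \<le> 0} \<noteq> 0"
  then have p: "p > 0" by (simp add: p_def E_def zero_less_measure_iff)
  have [measurable]: "Z n \<in> borel_measurable M" for n
    using Z by (rule linear_span_measurable)
  have [measurable]: "E \<in> sets M" by (simp add: E_def)
  note L2 = linear_span_law(1)[OF Z]
  have int: "integrable M (Z n)" for n
    using L2 by (rule square_integrable_integrable)
  have int_E: "integrable M (\<lambda>\<omega>. indicator E \<omega> * Z n \<omega>)" for n
    using integrable_mult_indicator[OF \<open>E \<in> sets M\<close> int[of n]] by simp
  \<comment> \<open>Anti-concentration yields the bound -(p / 4) (p / 2) = -2 \<eta> below;
    centering costs at most one \<eta> for large n, so -\<eta> remains.\<close>
  define \<eta> where "\<eta> = p\<^sup>2 / 16"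
  have "\<eta> > 0" using p by (simp add: \<eta>_def)
  have below: "expectation (\<lambda>\<omega>. indicator E \<omega> * Z n \<omega>) \<le> - 2 * \<eta>" for n
  proof -
    \<comment> \<open>An interval of length p / 2, which has probability at most p / 2 since the
      variance is 1. So at least half of \<open>E\<close> lies outside \<open>A\<close>, and there Z
      n is at most -p / 4.\<close>
    define A where "A = {\<omega>\<in>space M. Z n \<omega> \<in> {- (p / 4)..p / 4}}"
    have [measurable]: "A \<in> sets M" by (simp add: A_def)
    have "prob A \<le> (p / 4 - - (p / 4)) / sqrt (covariance M (Z n) (Z n))"
      unfolding A_def using p cov[of n n] by (intro linear_span_prob_Icc_le Z) simp_all
    then have "prob A \<le> p / 2" by (simp add: cov)
    moreover have "p \<le> prob (E - A) + prob A"
      unfolding p_def using measure_Un_le[of "E - A" M A] finite_measure_mono[of E "(E - A) \<union> A"]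
      by auto
    ultimately have "p / 2 \<le> prob (E - A)" by simp
    have "expectation (\<lambda>\<omega>. indicator E \<omega> * Z n \<omega>) \<le> expectation (\<lambda>\<omega>. - (p / 4) * indicator (E - A) \<omega>)"
    proof (rule integral_mono[OF int_E])
      show "integrable M (\<lambda>\<omega>. - (p / 4) * indicat_real (E - A) \<omega>)"
        by (intro integrable_mult_right integrable_real_indicator) (auto simp: emeasure_eq_measure)
      fix \<omega> assume "\<omega> \<in> space M"
      have nonpos: "Z n \<omega> \<le> 0" if "\<omega> \<in> E"
        using that by (simp add: E_def)
      have "Z n \<omega> \<le> - (p / 4)" if "\<omega> \<in> E" "\<omega> \<notin> A"
      proof -
        have "\<not> (- (p / 4) \<le> Z n \<omega> \<and> Z n \<omega> \<le> p / 4)"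
          using that(2) \<open>\<omega> \<in> space M\<close> by (simp add: A_def)
        with nonpos[OF that(1)] p show ?thesis by linarith
      qed
      with nonpos show "indicator E \<omega> * Z n \<omega> \<le> - (p / 4) * indicator (E - A) \<omega>"
        by (auto simp: indicator_def)
    qed
    also have "\<dots> = - (p / 4) * prob (E - A)"
      by simp
    also have "\<dots> \<le> - (p / 4) * (p / 2)"
      using p \<open>p / 2 \<le> prob (E - A)\<close> by (intro mult_left_mono_neg) auto
    also have "\<dots> = - 2 * \<eta>" by (simp add: \<eta>_def power2_eq_square)
    finally show ?thesis .
  qed
  obtain n0 where n0: "\<And>n. n \<ge> n0 \<Longrightarrow> \<bar>expectation (Z n)\<bar> < \<eta>"
    using LIMSEQ_D[OF mean \<open>\<eta> > 0\<close>] by auto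
  define Y where "Y n \<omega> = Z n \<omega> - expectation (Z n)" for n \<omega>
  have Y_L2: "square_integrable M (Y n)" for n
    using square_integrable_add[OF L2 square_integrable_const[of "- expectation (Z n)"], of n]
    by (simp add: Y_def[abs_def])
  have Y_E: "expectation (\<lambda>\<omega>. indicator E \<omega> * Y n \<omega>) \<le> - \<eta>" if "n \<ge> n0" for n
  proof -
    have "expectation (\<lambda>\<omega>. indicator E \<omega> * Y n \<omega>)
        = expectation (\<lambda>\<omega>. indicator E \<omega> * Z n \<omega> - expectation (Z n) * indicator E \<omega>)"
      by (simp add: Y_def algebra_simps)
    also have "\<dots> = expectation (\<lambda>\<omega>. indicator E \<omega> * Z n \<omega>) - expectation (Z n) * p"
      using int_E integrable_real_indicator[OF \<open>E \<in> sets M\<close>]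
      by (subst Bochner_Integration.integral_diff) (auto simp: p_def emeasure_eq_measure)
    also have "- expectation (Z n) * p \<le> \<eta> * 1"
    proof -
      have "- expectation (Z n) * p \<le> \<bar>expectation (Z n)\<bar> * p"
        using p by (intro mult_right_mono) auto
      also have "\<dots> \<le> \<eta> * 1"
        using n0[OF that] p \<open>\<eta> > 0\<close> prob_le_1[of E] by (intro mult_mono) (auto simp: p_def)
      finally show ?thesis .
    qed
    then have "expectation (\<lambda>\<omega>. indicator E \<omega> * Z n \<omega>) - expectation (Z n) * p \<le> - \<eta>"
      using below[of n] by simp
    finally show ?thesis .
  qed
  \<comment> \<open>The estimates below amount to (N \<eta>)^2 \<le> 4 N, which fails once N exceeds
    4 / \<eta>^2.\<close>
  obtain N :: nat where N: "real N > 4 / \<eta>\<^sup>2"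
    using reals_Archimedean2 by blast
  then have "N > 0" using \<open>\<eta> > 0\<close> by (auto intro!: gr0I simp: field_simps)
  define F where "F = {n0..<n0 + N}"
  define S where "S \<omega> = (\<Sum>n\<in>F. Y n \<omega>)" for \<omega>
  have S_L2: "square_integrable M S"
  proof -
    have "square_integrable M (\<lambda>\<omega>. \<Sum>n\<in>F. Y n \<omega>)" if "finite F" for F
      using that
    proof (induction F rule: finite_induct)
      case empty
      then show ?case using square_integrable_const[of 0] by simp
    next
      case (insert n F)
      with square_integrable_add[OF Y_L2[of n] insert.IH] show ?case by simp
    qed
    then show ?thesis by (simp add: S_def[abs_def] F_def)
  qed
  define W where "W \<omega> = indicator E \<omega> * S \<omega>" for \<omega>
  have W_L2: "square_integrable M W"
  proof -
    have [measurable]: "S \<in> borel_measurable M"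
      using S_L2 by (simp add: square_integrable_def)
    have "integrable M (\<lambda>\<omega>. indicator E \<omega> * (S \<omega>)\<^sup>2)"
      using integrable_mult_indicator[OF \<open>E \<in> sets M\<close>, of "\<lambda>\<omega>. (S \<omega>)\<^sup>2"] S_L2
      by (simp add: square_integrable_def)
    moreover have "(W \<omega>)\<^sup>2 = indicator E \<omega> * (S \<omega>)\<^sup>2" for \<omega>
      by (simp add: W_def indicator_def)
    moreover have "W \<in> borel_measurable M"
      by (simp add: W_def[abs_def])
    ultimately show ?thesis
      by (simp add: square_integrable_def)
  qed
  have "expectation W = (\<Sum>n\<in>F. expectation (\<lambda>\<omega>. indicator E \<omega> * Y n \<omega>))"
    using Y_L2 integrable_mult_indicator[OF \<open>E \<in> sets M\<close> square_integrable_integrable[OF Y_L2]]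
    by (simp add: W_def[abs_def] S_def sum_distrib_left)
  also have "\<dots> \<le> (\<Sum>n\<in>F. - \<eta>)"
    by (intro sum_mono Y_E) (simp add: F_def)
  also have "\<dots> = - (N * \<eta>)" by (simp add: F_def)
  finally have "N * \<eta> \<le> \<bar>expectation W\<bar>" by linarith
  then have "(N * \<eta>)\<^sup>2 \<le> (expectation W)\<^sup>2"
    using \<open>\<eta> > 0\<close> abs_le_square_iff[of "N * \<eta>" "expectation W"] by simp
  also have "\<dots> \<le> expectation (\<lambda>\<omega>. (W \<omega>)\<^sup>2)"
    using W_L2 variance_positive[of W] square_integrable_integrable[OF W_L2]
    by (subst (asm) variance_eq) (auto simp: square_integrable_def)
  also have "\<dots> \<le> expectation (\<lambda>\<omega>. (S \<omega>)\<^sup>2)"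
    using W_L2 S_L2 by (intro integral_mono) (auto simp: square_integrable_def W_def indicator_def)
  also have "\<dots> = expectation (\<lambda>\<omega>. \<Sum>n\<in>F. \<Sum>m\<in>F. Y n \<omega> * Y m \<omega>)"
    by (simp add: S_def power2_eq_square sum_product)
  also have "\<dots> = (\<Sum>n\<in>F. \<Sum>m\<in>F. expectation (\<lambda>\<omega>. Y n \<omega> * Y m \<omega>))"
    using square_integrable_mult[OF Y_L2 Y_L2] by simp
  also have "\<dots> = (\<Sum>n\<in>F. \<Sum>m\<in>F. (1 / 2) ^ ((n - m) + (m - n)))"
    by (simp add: Y_def covariance_def[symmetric] cov)
  also have "\<dots> \<le> (\<Sum>n\<in>F. 4)"
  proof (rule sum_mono)
    fix n
    have "(\<Sum>m\<in>F. (1 / 2 :: real) ^ ((n - m) + (m - n))) \<le> (\<Sum>m<n0 + N. (1 / 2) ^ ((n - m) + (m - n)))"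
      by (intro sum_mono2) (auto simp: F_def)
    also have "\<dots> \<le> 4" by (rule sum_half_power_dist_le)
    finally show "(\<Sum>m\<in>F. (1 / 2 :: real) ^ ((n - m) + (m - n))) \<le> 4" .
  qed
  also have "\<dots> = 4 * N" by (simp add: F_def)
  finally have "N * (N * \<eta>\<^sup>2) \<le> N * 4"
    by (simp add: power2_eq_square algebra_simps)
  then have "N * \<eta>\<^sup>2 \<le> 4" using \<open>N > 0\<close> by simp
  with N \<open>\<eta> > 0\<close> show False by (simp add: field_simps)
qed

end

section \<open>Two-sided Brownian motion with drift\<close>

locale drifted_brownian_motion = gaussian M G for M :: "'a measure" and G :: "real \<Rightarrow> 'a \<Rightarrow> real" +
  fixes C :: real and \<mu> :: "real \<Rightarrow> real"
  assumes C: "C > 0"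
    and mean: "\<And>v. expectation (G v) = \<mu> v"
    and cov: "\<And>v u. covariance M (G v) (G u) = C * min \<bar>v\<bar> \<bar>u\<bar> * of_bool (sgn v = sgn u)"
    and paths: "AE \<omega> in M. continuous_on UNIV (\<lambda>v. G v \<omega> - \<mu> v)"
    and \<mu>: "\<And>v. ((\<lambda>\<delta>. (\<mu> (v + \<delta>) - \<mu> v) / sqrt \<delta>) \<longlongrightarrow> 0) (at_right 0)"
begin

text \<open>The point 0 may join the nonnegative half-line: its sign differs from that of positive
  times, but the minimum with 0 vanishes anyway.\<close>

lemma covariance_cases:
  "0 \<le> u \<Longrightarrow> 0 \<le> v \<Longrightarrow> covariance M (G u) (G v) = C * min u v"
  "u < 0 \<Longrightarrow> v < 0 \<Longrightarrow> covariance M (G u) (G v) = - C * max u v"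
  "u < 0 \<Longrightarrow> 0 \<le> v \<Longrightarrow> covariance M (G u) (G v) = 0"
  "0 \<le> u \<Longrightarrow> v < 0 \<Longrightarrow> covariance M (G u) (G v) = 0"
  unfolding cov by (auto simp: sgn_if min_def max_def)

lemma covariance_increment:
  "covariance M (G u) (\<lambda>\<omega>. G q \<omega> - G p \<omega>) = covariance M (G u) (G q) - covariance M (G u) (G p)"
  by (rule covariance_diff_right) (rule linear_span_base)+

lemma covariance_increments:
  assumes "x \<le> u" "x \<le> v" "0 \<le> x \<or> u < 0 \<and> v < 0"
  shows "covariance M (\<lambda>\<omega>. G u \<omega> - G x \<omega>) (\<lambda>\<omega>. G v \<omega> - G x \<omega>) = C * (min u v - x)"
proof -
  have "covariance M (\<lambda>\<omega>. G u \<omega> - G x \<omega>) (\<lambda>\<omega>. G v \<omega> - G x \<omega>)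
      = covariance M (G u) (G v) - covariance M (G u) (G x) - (covariance M (G x) (G v) - covariance M (G x) (G x))"
    by (simp add: covariance_diff_left covariance_increment linear_span_base linear_span_diff)
  then show ?thesis
    using assms by (cases "0 \<le> x") (auto simp: covariance_cases min_absorb1 min_absorb2 max_absorb1 max_absorb2
        min_def max_def algebra_simps split: if_splits)
qed

text \<open>The process runs outward from 0. On the positive side the increment is a part of
  \<open>G t\<close> for t to its right only, so the coefficients are 0 and 1; on the negative side
  it enters with a minus sign for t to its left only, so they are -1 and 0. Either way they differ
  by one.\<close>

lemma AE_suprema_distinct_brownian:
  assumes "p < q" "0 < p \<or> q < 0"
  shows "AE \<omega> in M. (SUP t\<in>\<rat> \<inter> {..<p}. ereal (G t \<omega>)) = (SUP t\<in>\<rat> \<inter> {q..}. ereal (G t \<omega>))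
    \<longrightarrow> \<bar>SUP t\<in>\<rat> \<inter> {..<p}. ereal (G t \<omega>)\<bar> = \<infinity>"
proof (rule AE_suprema_distinct)
  let ?N = "\<lambda>\<omega>. G q \<omega> - G p \<omega>"
  have var: "covariance M ?N ?N = C * (q - p)"
    using covariance_increments[of p q q] assms by auto
  show "?N \<in> linear_span G" by (intro linear_span_diff linear_span_base)
  show "covariance M ?N ?N > 0" using var assms C by simp
  show "countable (\<rat> \<inter> {..<p})" "countable (\<rat> \<inter> {q..})"
    using countable_rat by (auto intro: countable_subset)
  show "\<rat> \<inter> {..<p} \<noteq> {}" "\<rat> \<inter> {q..} \<noteq> {}"
    using Rats_dense_in_real[of "p - 1" p] Rats_dense_in_real[of q "q + 1"] by force+
  show "covariance M (G t) ?N = (if 0 < p then 0 else -1) * covariance M ?N ?N" if "t \<in> \<rat> \<inter> {..<p}" for t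
    using that assms unfolding var covariance_increment
    by (cases "0 < p"; cases "0 \<le> t") (auto simp: covariance_cases min_def max_def algebra_simps)
  show "covariance M (G t) ?N = ((if 0 < p then 0 else -1) + 1) * covariance M ?N ?N" if "t \<in> \<rat> \<inter> {q..}" for t
    using that assms unfolding var covariance_increment
    by (cases "0 < p"; cases "0 \<le> t") (auto simp: covariance_cases min_def max_def algebra_simps)
qed

lemma AE_not_maximizer: "AE \<omega> in M. \<not> (\<forall>u. G u \<omega> \<le> G x \<omega>)"
proof -
  \<comment> \<open>For negative x this keeps x + d0 = x / 2 negative, so all increments from x stay
    on one side of 0.\<close>
  define d0 where "d0 = (if x < 0 then - x / 2 else 1)"
  define d where "d n = d0 / 4 ^ n" for n
  have d0: "d0 > 0" by (simp add: d0_def)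
  then have d: "d n > 0" "d n \<le> d0" for n
    by (auto simp: d_def field_simps)
  have sqrt_d: "sqrt (d n) = sqrt d0 / 2 ^ n" for n
    by (simp add: d_def real_sqrt_divide real_sqrt_power)
  define Z where "Z n \<omega> = 1 / sqrt (C * d n) * (G (x + d n) \<omega> - G x \<omega>)" for n \<omega>
  have inc: "(\<lambda>\<omega>. G (x + d n) \<omega> - G x \<omega>) \<in> linear_span G" for n
    by (intro linear_span_diff linear_span_base)
  have Z: "Z n \<in> linear_span G" for n
    unfolding Z_def[abs_def] by (intro linear_span_scale inc)
  have "prob {\<omega>\<in>space M. \<forall>n. Z n \<omega> \<le> 0} = 0"
  proof (rule prob_all_nonpos_eq_0[OF Z])
    fix n m
    have *: "covariance M (\<lambda>\<omega>. G (x + d n) \<omega> - G x \<omega>) (\<lambda>\<omega>. G (x + d m) \<omega> - G x \<omega>) = C * min (d n) (d m)"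
      using d[of n] d[of m] by (subst covariance_increments) (auto simp: d0_def split: if_splits)
    have "covariance M (Z n) (Z m) = 1 / sqrt (C * d n) * (1 / sqrt (C * d m)) * (C * min (d n) (d m))"
      unfolding *[symmetric] Z_def[abs_def]
      by (simp add: covariance_scale_left linear_span_law(1)[OF inc] linear_span_law(1)[OF linear_span_scale[OF inc]]
          covariance_commute[of M "\<lambda>\<omega>. G (x + d n) \<omega> - G x \<omega>"] del: times_divide_eq_left)
    also have "\<dots> = min (d n) (d m) / (sqrt (d n) * sqrt (d m))"
    proof -
      have "1 / (r * a) * (1 / (r * b)) * (r * r * m) = m / (a * b)" if "r > 0" "a > 0" "b > 0" for r a b m :: real
        using that by (simp add: field_simps)
      from this[of "sqrt C" "sqrt (d n)" "sqrt (d m)" "min (d n) (d m)"] show ?thesis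
        using C d by (simp add: real_sqrt_mult)
    qed
    also have "\<dots> = (1 / 2) ^ ((n - m) + (m - n))"
    proof -
      have le: "min (d a) (d b) / (sqrt (d a) * sqrt (d b)) = (1 / 2) ^ (b - a)" if "a \<le> b" for a b
      proof -
        have "min (d a) (d b) = d b"
          using d0 that by (auto simp: d_def min_def field_simps)
        also have "\<dots> = sqrt (d b) * sqrt (d b)" using d(1)[of b] by simp
        finally have min: "min (d a) (d b) = sqrt (d b) * sqrt (d b)" .
        have "min (d a) (d b) / (sqrt (d a) * sqrt (d b)) = sqrt (d b) / sqrt (d a)"
          unfolding min using d(1)[of b] by (simp del: real_sqrt_mult_self)
        also have "\<dots> = 2 ^ a / 2 ^ b" using d0 by (simp add: sqrt_d)
        also have "\<dots> = (1 / 2) ^ (b - a)" using that by (simp add: power_diff power_one_over)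
        finally show ?thesis .
      qed
      show ?thesis
        using le[of n m] le[of m n] by (cases "n \<le> m") (auto simp: min.commute mult.commute)
    qed
    finally show "covariance M (Z n) (Z m) = (1 / 2) ^ ((n - m) + (m - n))" .
  next
    have "(\<lambda>n. d0 * (1 / 4) ^ n) \<longlonglongrightarrow> d0 * 0"
      by (intro tendsto_mult tendsto_const LIMSEQ_power_zero) simp
    then have "d \<longlonglongrightarrow> 0" by (simp add: d_def[abs_def] power_one_over)
    then have "filterlim d (at_right 0) sequentially"
      using d(1) by (auto simp: filterlim_at less_imp_neq[symmetric])
    \<comment> \<open>Up to the factor 1 / sqrt C, the mean of \<open>Z n\<close> is the difference
      quotient of the drift hypothesis at \<delta> = d n.\<close>
    from filterlim_compose[OF \<mu>[of x] this]
    have "(\<lambda>n. 1 / sqrt C * ((\<mu> (x + d n) - \<mu> x) / sqrt (d n))) \<longlonglongrightarrow> 1 / sqrt C * 0"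
      by (intro tendsto_mult tendsto_const)
    moreover have "expectation (Z n) = 1 / sqrt C * ((\<mu> (x + d n) - \<mu> x) / sqrt (d n))" for n
      using square_integrable_integrable[OF linear_span_law(1)[OF linear_span_base]]
      by (simp add: Z_def[abs_def] mean real_sqrt_mult)
    ultimately show "(\<lambda>n. expectation (Z n)) \<longlonglongrightarrow> 0" by simp
  qed
  moreover have [measurable]: "Z n \<in> borel_measurable M" for n
    using Z by (rule linear_span_measurable)
  ultimately have "AE \<omega> in M. \<not> (\<forall>n. Z n \<omega> \<le> 0)"
    by (intro AE_I'[of "{\<omega>\<in>space M. \<forall>n. Z n \<omega> \<le> 0}"]) (auto simp: emeasure_eq_measure)
  then show ?thesis
  proof eventually_elim
    case (elim \<omega>)
    then obtain n where "Z n \<omega> > 0" by (auto simp: not_le)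
    then have "G (x + d n) \<omega> > G x \<omega>"
      using mult_pos_pos[OF C d(1)[of n]] by (auto simp: Z_def zero_less_divide_iff)
    then show ?case by (meson not_le)
  qed
qed

text \<open>The increment of \<open>\<mu>\<close> is the quotient of the hypothesis times sqrt
  \<delta>, and both factors tend to 0. Nothing follows about left limits.\<close>

lemma \<mu>_right_continuous: "(\<mu> \<longlongrightarrow> \<mu> v) (at_right v)"
proof -
  have "((\<lambda>\<delta>. (\<mu> (v + \<delta>) - \<mu> v) / sqrt \<delta> * sqrt \<delta> + \<mu> v) \<longlongrightarrow> 0 * sqrt 0 + \<mu> v) (at_right 0)"
    by (intro tendsto_add tendsto_mult \<mu> tendsto_const tendsto_real_sqrt tendsto_ident_at)
  moreover have "\<forall>\<^sub>F \<delta> in at_right 0. (\<mu> (v + \<delta>) - \<mu> v) / sqrt \<delta> * sqrt \<delta> + \<mu> v = \<mu> (\<delta> + v)"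
    using eventually_at_right_less[of 0] by eventually_elim (simp add: add.commute)
  ultimately show ?thesis
    unfolding filterlim_at_right_to_0[of _ _ v] by (simp add: filterlim_cong)
qed

lemma AE_right_continuous: "AE \<omega> in M. \<forall>v. ((\<lambda>u. G u \<omega>) \<longlongrightarrow> G v \<omega>) (at_right v)"
  using paths
proof eventually_elim
  case (elim \<omega>)
  show ?case
  proof
    fix v
    have "((\<lambda>u. G u \<omega> - \<mu> u) \<longlongrightarrow> G v \<omega> - \<mu> v) (at_right v)"
      using elim by (auto simp: continuous_on_def intro: tendsto_within_subset)
    from tendsto_add[OF this \<mu>_right_continuous[of v]]
    show "((\<lambda>u. G u \<omega>) \<longlongrightarrow> G v \<omega>) (at_right v)" by simp
  qed
qed

end

subsection \<open>The unique maximizer\<close>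

text \<open>The restriction to rationals makes this a countable supremum, hence measurable along the
  paths; extended reals avoid any boundedness requirement.\<close>

definition rat_sup :: "(real \<Rightarrow> real) \<Rightarrow> real set \<Rightarrow> ereal" where
  "rat_sup g A = (SUP t\<in>\<rat> \<inter> A. ereal (g t))"

text \<open>A countable infimum that makes sense for every function, with \<infinity> as the neutral
  value for thresholds that fail. It is \<infinity> if no threshold qualifies and -\<infinity> if
  all do, since qualifying passes on to larger thresholds.\<close>

definition argmax_level :: "(real \<Rightarrow> real) \<Rightarrow> ereal" where
  "argmax_level g = (INF r\<in>\<rat>. if rat_sup g {..<r} = rat_sup g UNIV then ereal r else \<infinity>)"

lemma rat_sup_mono: "A \<subseteq> B \<Longrightarrow> rat_sup g A \<le> rat_sup g B"
  unfolding rat_sup_def by (intro SUP_subset_mono) auto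

locale right_continuous_function =
  fixes g :: "real \<Rightarrow> real"
  assumes right_cont: "\<And>v. (g \<longlongrightarrow> g v) (at_right v)"
begin

text \<open>By right-continuity, values at rationals just to the right of \<open>v\<close> come
  arbitrarily close to \<open>g v\<close>. So \<open>A\<close> need only contain a right
  neighbourhood of \<open>v\<close>, which serves both \<open>{..<r}\<close> with v < r and
  \<open>{q..}\<close> with q < v.\<close>

lemma le_rat_sup:
  assumes "v < b" "{v<..<b} \<subseteq> A"
  shows "ereal (g v) \<le> rat_sup g A"
proof (rule ccontr)
  assume "\<not> ereal (g v) \<le> rat_sup g A"
  then have less: "rat_sup g A < ereal (g v)" by simp
  have "\<forall>\<^sub>F u in at_right v. rat_sup g A < ereal (g u)"
    using right_cont[of v] less by (intro order_tendstoD(1)[of _ "ereal (g v)"]) (auto intro: tendsto_intros)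
  then obtain b' where b': "b' > v" "\<And>u. v < u \<Longrightarrow> u < b' \<Longrightarrow> rat_sup g A < ereal (g u)"
    unfolding eventually_at_right_field by blast
  obtain r where r: "r \<in> \<rat>" "v < r" "r < min b b'"
    using Rats_dense_in_real[of v "min b b'"] b'(1) assms(1) by auto
  then have "ereal (g r) \<le> rat_sup g A"
    unfolding rat_sup_def using assms by (intro SUP_upper) auto
  moreover have "rat_sup g A < ereal (g r)" using b'(2) r by simp
  ultimately show False by simp
qed

lemma le_rat_sup_UNIV: "ereal (g v) \<le> rat_sup g UNIV"
  by (rule le_rat_sup[of v "v + 1"]) auto

lemma argmax_if_eq_rat_sup:
  assumes "ereal (g v) = rat_sup g UNIV"
  shows "is_arg_max g (\<lambda>_. True) v"
proof -
  have "g u \<le> g v" for u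
    using le_rat_sup_UNIV[of u] by (simp flip: assms)
  then show ?thesis by (auto simp: is_arg_max_def not_less)
qed

end

text \<open>The pathwise form of the almost sure absence of ties; rational \<open>p\<close> and
  \<open>q\<close> keep the exceptional set a countable union of null sets.\<close>

locale tie_free_function = right_continuous_function +
  assumes no_ties: "\<And>p q. p \<in> \<rat> \<Longrightarrow> q \<in> \<rat> \<Longrightarrow> p < q \<Longrightarrow> 0 < p \<or> q < 0 \<Longrightarrow>
    rat_sup g {..<p} = rat_sup g {q..} \<Longrightarrow> \<bar>rat_sup g {..<p}\<bar> = \<infinity>"
begin

text \<open>Thresholds r > v qualify by right-continuity. If some r < v qualified, then for p < q
  between r and v the suprema left of p and from q on would both be the finite value
  \<open>g v\<close>, a forbidden tie. Since \<open>argmax_level g\<close> does not mention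
  \<open>v\<close>, the maximizer is also unique.\<close>

lemma argmax_level_eq:
  assumes "is_arg_max g (\<lambda>_. True) v"
  shows "argmax_level g = ereal v" "rat_sup g UNIV = ereal (g v)"
proof -
  have max: "g u \<le> g v" for u
    using assms by (auto simp: is_arg_max_def not_less)
  show sup: "rat_sup g UNIV = ereal (g v)"
  proof (rule antisym)
    show "rat_sup g UNIV \<le> ereal (g v)"
      unfolding rat_sup_def by (intro SUP_least) (simp add: max)
  qed (rule le_rat_sup_UNIV)
  have le: "rat_sup g A \<le> ereal (g v)" for A
    using rat_sup_mono[of A UNIV g] sup by simp
  have above: "rat_sup g {..<r} = ereal (g v)" if "v < r" for r
  proof -
    have "{v<..<r} \<subseteq> {..<r}" by auto
    from antisym[OF le le_rat_sup[OF that this]] show ?thesis .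
  qed
  have below: "rat_sup g {..<r} \<noteq> ereal (g v)" if r: "r < v" for r
  proof
    assume eq: "rat_sup g {..<r} = ereal (g v)"
    obtain p q where pq: "p \<in> \<rat>" "q \<in> \<rat>" "r < p" "p < q" "q < v" "0 < p \<or> q < 0"
    proof -
      \<comment> \<open>The two thresholds must lie on one side of 0: for v \<le> 0 every point of
        (r, v) is negative, otherwise the interval is cut at 0 and its points are positive.\<close>
      define a b where "a = (if v \<le> 0 then r else max r 0)" and "b = v"
      have "a < b" using r by (simp add: a_def b_def)
      obtain p where p: "p \<in> \<rat>" "a < p" "p < b"
        using Rats_dense_in_real[OF \<open>a < b\<close>] by blast
      obtain q where q: "q \<in> \<rat>" "p < q" "q < b"
        using Rats_dense_in_real[OF p(3)] by blast
      show thesis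
        using p q by (intro that[of p q]) (auto simp: a_def b_def split: if_splits)
    qed
    have "rat_sup g {..<p} = ereal (g v)"
      using eq le[of "{..<p}"] rat_sup_mono[of "{..<r}" "{..<p}" g] pq(3) by (intro antisym) auto
    moreover have "rat_sup g {q..} = ereal (g v)"
    proof -
      have "{v<..<v + 1} \<subseteq> {q..}" using pq(5) by auto
      from antisym[OF le le_rat_sup[OF _ this]] show ?thesis by simp
    qed
    ultimately show False using no_ties[OF pq(1,2,4,6)] by simp
  qed
  show "argmax_level g = ereal v"
  proof (rule antisym)
    show "ereal v \<le> argmax_level g"
      unfolding argmax_level_def sup
    proof (rule INF_greatest)
      fix r :: real
      show "ereal v \<le> (if rat_sup g {..<r} = ereal (g v) then ereal r else \<infinity>)"
        using below[of r] by (cases "r < v") auto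
    qed
    show "argmax_level g \<le> ereal v"
    proof (rule ereal_le_epsilon2)
      fix e :: real assume "0 < e"
      then obtain r where r: "r \<in> \<rat>" "v < r" "r < v + e"
        using Rats_dense_in_real[of v "v + e"] by auto
      have "argmax_level g \<le> (if rat_sup g {..<r} = rat_sup g UNIV then ereal r else \<infinity>)"
        unfolding argmax_level_def by (intro INF_lower r)
      also have "\<dots> = ereal r" using above[OF r(2)] sup by simp
      also have "\<dots> \<le> ereal v + ereal e" using r by simp
      finally show "argmax_level g \<le> ereal v + ereal e" .
    qed
  qed
qed

text \<open>This replaces the choice operator by conditions on \<open>argmax_level g\<close> that
  become measurable along the paths. Existence of a maximizer has to be tested by comparing the
  value at the candidate with the supremum, for a finite \<open>argmax_level g\<close> need not be a
  maximizer.\<close>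

lemma unique_argmax_le_iff:
  "(\<exists>!v. is_arg_max g (\<lambda>_. True) v) \<and> arg_max g (\<lambda>_. True) \<le> x \<longleftrightarrow>
    \<bar>argmax_level g\<bar> \<noteq> \<infinity> \<and> ereal (g (real_of_ereal (argmax_level g))) = rat_sup g UNIV
    \<and> real_of_ereal (argmax_level g) \<le> x"
  (is "?L \<longleftrightarrow> ?R")
proof
  assume ?L
  then have "is_arg_max g (\<lambda>_. True) (arg_max g (\<lambda>_. True))"
    unfolding arg_max_def by (blast intro: someI)
  from argmax_level_eq[OF this] \<open>?L\<close> show ?R by simp
next
  assume R: ?R
  define v where "v = real_of_ereal (argmax_level g)"
  have v: "is_arg_max g (\<lambda>_. True) v"
    using R by (intro argmax_if_eq_rat_sup) (simp add: v_def)
  have uniq: "w = v" if "is_arg_max g (\<lambda>_. True) w" for w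
    using argmax_level_eq(1)[OF that] by (simp add: v_def)
  have "arg_max g (\<lambda>_. True) = v"
    unfolding arg_max_def using v uniq by (rule some_equality)
  moreover have "\<exists>!v. is_arg_max g (\<lambda>_. True) v"
    using v uniq by (rule ex1I)
  ultimately show ?L using R by (simp add: v_def)
qed

end

text \<open>The least multiple of 1 / (n + 1) strictly above \<open>v\<close>. Its countable range
  allows the process to be evaluated measurably at a random time, and lying strictly above
  \<open>v\<close> lets right-continuity recover the value at \<open>v\<close> itself.\<close>

definition grid_above :: "nat \<Rightarrow> real \<Rightarrow> real" where
  "grid_above n v = (of_int \<lfloor>real (Suc n) * v\<rfloor> + 1) / real (Suc n)"

lemma grid_above_at_right: "filterlim (\<lambda>n. grid_above n v) (at_right v) sequentially"
proof -
  have gt: "v < grid_above n v" for n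
    using real_of_int_floor_add_one_gt[of "real (Suc n) * v"]
    by (simp add: grid_above_def field_simps)
  have le: "grid_above n v \<le> v + 1 / real (Suc n)" for n
  proof -
    have "grid_above n v \<le> (real (Suc n) * v + 1) / real (Suc n)"
      unfolding grid_above_def by (intro divide_right_mono add_right_mono of_int_floor_le) simp
    also have "\<dots> = v + 1 / real (Suc n)"
      by (simp add: add_divide_distrib del: of_nat_Suc)
    finally show ?thesis .
  qed
  have "(\<lambda>n. v + 1 / real (Suc n)) \<longlonglongrightarrow> v + 0"
    by (intro tendsto_add tendsto_const LIMSEQ_Suc[OF lim_1_over_n])
  then have upper: "(\<lambda>n. v + 1 / real (Suc n)) \<longlonglongrightarrow> v"
    unfolding add_0_right .
  have "(\<lambda>n. grid_above n v) \<longlonglongrightarrow> v"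
  proof (rule tendsto_sandwich[OF _ _ tendsto_const upper])
    show "\<forall>\<^sub>F n in sequentially. v \<le> grid_above n v"
      by (intro always_eventually allI less_imp_le gt)
    show "\<forall>\<^sub>F n in sequentially. grid_above n v \<le> v + 1 / real (Suc n)"
      by (intro always_eventually allI le)
  qed
  moreover have "\<forall>\<^sub>F n in sequentially. grid_above n v \<in> {v<..} \<and> grid_above n v \<noteq> v"
    using gt by (simp add: less_imp_neq[symmetric])
  ultimately show ?thesis by (simp add: filterlim_at)
qed

text \<open>The probability is the distribution function of the law of \<open>W\<close> restricted
  to \<open>B\<close>, a finite Borel measure whose total mass may be below 1; such a function is
  continuous exactly where the measure has no atom.\<close>

lemma (in prob_space) continuous_on_prob_le:
  assumes [measurable]: "B \<in> sets M" "W \<in> borel_measurable M"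
    and atoms: "\<And>x. prob (B \<inter> {\<omega>\<in>space M. W \<omega> = x}) = 0"
  shows "continuous_on UNIV (\<lambda>x::real. prob (B \<inter> {\<omega>\<in>space M. W \<omega> \<le> x}))"
proof -
  define \<nu> where "\<nu> = distr (density M (indicator B)) borel W"
  have eq: "measure \<nu> A = prob (B \<inter> {\<omega>\<in>space M. W \<omega> \<in> A})" if [measurable]: "A \<in> sets borel" for A
  proof -
    have "emeasure \<nu> A = emeasure (density M (indicator B)) {\<omega>\<in>space M. W \<omega> \<in> A}"
      by (simp add: \<nu>_def emeasure_distr vimage_def Int_def conj_commute)
    also have "\<dots> = emeasure M (B \<inter> {\<omega>\<in>space M. W \<omega> \<in> A})"
      by (simp add: emeasure_density indicator_inter_arith[symmetric])
    finally show ?thesis by (simp add: measure_def)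
  qed
  interpret \<nu>: finite_borel_measure \<nu>
  proof (intro finite_borel_measure.intro finite_measureI finite_borel_measure_axioms.intro)
    show "emeasure \<nu> (space \<nu>) \<noteq> \<infinity>"
      by (simp add: \<nu>_def emeasure_distr emeasure_density emeasure_eq_measure)
  qed (simp add: \<nu>_def)
  have "isCont (cdf \<nu>) x" for x
    using atoms[of x] eq[of "{x}"] by (simp add: \<nu>.isCont_cdf)
  moreover have "cdf \<nu> = (\<lambda>x. prob (B \<inter> {\<omega>\<in>space M. W \<omega> \<le> x}))"
    by (simp add: fun_eq_iff cdf_def eq)
  ultimately show ?thesis
    by (auto intro: continuous_at_imp_continuous_on)
qed

section \<open>Continuity of the distribution function of the maximizer\<close>

context drifted_brownian_motion
begin

lemma AE_tie_free: "AE \<omega> in M. tie_free_function (\<lambda>t. G t \<omega>)"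
proof -
  have "AE \<omega> in M. \<forall>p\<in>\<rat>. \<forall>q\<in>\<rat>. p < q \<and> (0 < p \<or> q < 0) \<longrightarrow>
      rat_sup (\<lambda>t. G t \<omega>) {..<p} = rat_sup (\<lambda>t. G t \<omega>) {q..} \<longrightarrow> \<bar>rat_sup (\<lambda>t. G t \<omega>) {..<p}\<bar> = \<infinity>"
    using AE_suprema_distinct_brownian
    by (intro AE_ball_countable' countable_rat) (auto simp: rat_sup_def)
  with AE_right_continuous show ?thesis
    by eventually_elim (unfold_locales, auto)
qed

theorem continuous_on_argmax_cdf: "continuous_on UNIV (argmax_cdf M G)"
proof -
  define V where "V \<omega> = argmax_level (\<lambda>t. G t \<omega>)" for \<omega>
  define W where "W \<omega> = real_of_ereal (V \<omega>)" for \<omega>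
  define S where "S \<omega> = rat_sup (\<lambda>t. G t \<omega>) UNIV" for \<omega>
  \<comment> \<open>A limsup is defined and measurable on the whole space; it is the value of the
    path at \<open>W\<close> wherever the path is tie-free.\<close>
  define GW where "GW \<omega> = limsup (\<lambda>n. ereal (G (grid_above n (W \<omega>)) \<omega>))" for \<omega>
  \<comment> \<open>On tie-free paths this is the event that a unique maximizer exists, and the
    maximizer is then \<open>W\<close>.\<close>
  define B where "B = {\<omega>\<in>space M. \<bar>V \<omega>\<bar> \<noteq> \<infinity> \<and> GW \<omega> = S \<omega>}"
  have sup_measurable [measurable]: "(\<lambda>\<omega>. rat_sup (\<lambda>t. G t \<omega>) A) \<in> borel_measurable M" for A
    unfolding rat_sup_def by (intro borel_measurable_SUP) (auto intro: countable_subset[OF _ countable_rat])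
  have [measurable]: "S \<in> borel_measurable M" by (simp add: S_def[abs_def])
  have [measurable]: "V \<in> borel_measurable M"
    unfolding V_def[abs_def] argmax_level_def by (intro borel_measurable_INF countable_rat) simp
  have [measurable]: "W \<in> borel_measurable M" by (simp add: W_def[abs_def])
  \<comment> \<open>The floor takes integer values, so the random time reduces to countably many
    fixed times.\<close>
  have "(\<lambda>\<omega>. G (grid_above n (W \<omega>)) \<omega>) \<in> borel_measurable M" for n
    unfolding grid_above_def
    by (rule measurable_compose_countable[where f = "\<lambda>k. G ((of_int k + 1) / real (Suc n))"]) simp_all
  then have [measurable]: "GW \<in> borel_measurable M"
    unfolding GW_def[abs_def] by measurable
  have B [measurable]: "B \<in> sets M"
    unfolding B_def by measurable
  have GW: "GW \<omega> = ereal (G (W \<omega>) \<omega>)" if "tie_free_function (\<lambda>t. G t \<omega>)" for \<omega>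
  proof -
    interpret tie_free_function "\<lambda>t. G t \<omega>" by fact
    have "(\<lambda>n. ereal (G (grid_above n (W \<omega>)) \<omega>)) \<longlonglongrightarrow> ereal (G (W \<omega>) \<omega>)"
      by (intro tendsto_intros filterlim_compose[OF right_cont grid_above_at_right])
    then show ?thesis
      unfolding GW_def by (intro lim_imp_Limsup) auto
  qed
  have cdf_eq: "argmax_cdf M G x = prob (B \<inter> {\<omega>\<in>space M. W \<omega> \<le> x})" for x
  proof -
    let ?A = "{\<omega> \<in> space M. (\<exists>!v. is_arg_max (\<lambda>v. G v \<omega>) (\<lambda>_. True) v) \<and> arg_max (\<lambda>v. G v \<omega>) (\<lambda>_. True) \<le> x}"
    let ?B = "B \<inter> {\<omega>\<in>space M. W \<omega> \<le> x}"
    have "AE \<omega> in M. \<omega> \<in> ?B \<longleftrightarrow> \<omega> \<in> ?A"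
      using AE_tie_free AE_space
    proof eventually_elim
      case (elim \<omega>)
      then show ?case
        using tie_free_function.unique_argmax_le_iff[OF elim(1), of x] GW[OF elim(1)]
        by (simp add: B_def W_def V_def S_def)
    qed
    then have AE: "AE \<omega> in completion M. \<omega> \<in> ?B \<longleftrightarrow> \<omega> \<in> ?A"
      by (rule AE_completion)
    have "?B \<in> sets (completion M)" by (intro sets_completionI_sets) measurable
    \<comment> \<open>Measurability of the argmax event is obtained here, from its agreement with
      \<open>?B\<close> outside a null set.\<close>
    then have "?A \<in> sets (completion M)"
      using completion.in_sets_AE[OF AE] by auto
    have "measure (completion M) ?A = measure (completion M) ?B"
      using AE \<open>?A \<in> sets (completion M)\<close> \<open>?B \<in> sets (completion M)\<close>
      by (intro measure_eq_AE) auto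
    also have "\<dots> = prob ?B" by (simp add: measure_completion)
    finally show ?thesis by (simp add: argmax_cdf_def)
  qed
  have "prob (B \<inter> {\<omega>\<in>space M. W \<omega> = x}) = 0" for x
  proof -
    have "AE \<omega> in M. \<omega> \<notin> B \<inter> {\<omega>\<in>space M. W \<omega> = x}"
      using AE_tie_free AE_not_maximizer[of x]
    proof eventually_elim
      case (elim \<omega>)
      interpret tie_free_function "\<lambda>t. G t \<omega>" by fact
      show ?case
      proof
        assume "\<omega> \<in> B \<inter> {\<omega>\<in>space M. W \<omega> = x}"
        then have "is_arg_max (\<lambda>t. G t \<omega>) (\<lambda>_. True) x"
          using GW[OF elim(1)] by (intro argmax_if_eq_rat_sup) (auto simp: B_def S_def)
        with elim(2) show False by (auto simp: is_arg_max_def not_less)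
      qed
    qed
    then show ?thesis by (simp add: prob_eq_0)
  qed
  then have "continuous_on UNIV (\<lambda>x. prob (B \<inter> {\<omega>\<in>space M. W \<omega> \<le> x}))"
    by (intro continuous_on_prob_le) measurable
  moreover have "argmax_cdf M G = (\<lambda>x. prob (B \<inter> {\<omega>\<in>space M. W \<omega> \<le> x}))"
    using cdf_eq by (rule ext)
  ultimately show ?thesis by simp
qed

end

theorem lemmaA2:
  fixes M :: "'a measure" and G :: "real \<Rightarrow> 'a \<Rightarrow> real" and \<mu> :: "real \<Rightarrow> real"
    and C c :: real
  assumes "prob_space M"
    and "gaussian_process M G"
    and "C > 0"
    and "\<And>v. integral\<^sup>L M (G v) = \<mu> v"
    and "\<And>v u. covariance M (G v) (G u) = C * min \<bar>v\<bar> \<bar>u\<bar> * of_bool (sgn v = sgn u)"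
    and "AE \<omega> in M. continuous_on UNIV (\<lambda>v. G v \<omega> - \<mu> v) \<and> G 0 \<omega> - \<mu> 0 = 0"
    and "\<And>v. ((\<lambda>\<delta>. (\<mu> (v + \<delta>) - \<mu> v) / sqrt \<delta>) \<longlongrightarrow> 0) (at_right 0)"
    and "c > 1 / 2"
    and "Limsup at_infinity (\<lambda>v. ereal (\<mu> v / \<bar>v\<bar> powr c)) = - \<infinity>"
  shows "continuous_on UNIV (argmax_cdf M G)"
proof -
  interpret prob_space M by fact
  interpret drifted_brownian_motion M G C \<mu>
    using assms by unfold_locales auto
  show ?thesis by (rule continuous_on_argmax_cdf)
qed

end
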